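(* Let $A$ and $B$ be rings with local units and let $F:\mathcal{M}_A\to\mathcal{M}_B$ be a continuous functor. For every idempotent $e\in\mathrm{Idemp}(A)$ we have $$\Upsilon_{eA}\circ\Theta_{eA}=\mathrm{id}_{eA\otimes_AF(A)},\qquad \Theta_{eA}\circ\Upsilon_{eA}=\mathrm{id}_{F(eA)}.$$ In particular, $\Upsilon_-$ (defined on the right modules $eA$, $e\in\mathrm{Idemp}(A)$) extends uniquely to a natural isomorphism $\Upsilon^F_-:F(-)\to-\otimes_AF(A)$ of functors on $\mathcal{M}_A$, and $F(A)$ is a unital left $A$-module, and thus a unital $(A,B)$-bimodule.
   Context: $\mathbb{K}$ is a commutative ring with identity. A ring with local units is an associative $\mathbb{K}$-algebra $A$ (not necessarily with identity) such that for all $a_1,\dots,a_n\in A$ there is an idempotent $e\in A$ with $a_ie=ea_i=a_i$ for all $i$; $\mathrm{Idemp}(A)$ is its set of idempotents. A right $A$-module $X$ is unital if $XA=X$ (equivalently, every $x\in X$ satisfies $xe=x$ for some $e\in\mathrm{Idemp}(A)$); similarly on the left. $\mathcal{M}_A$ is the category of unital right $A$-modules and $A$-linear maps. An $(A,B)$-bimodule (left $A$-action and right $B$-action that commute; the $\mathbb{K}$-actions induced from the two sides are not required to coincide) is unital if it is unital on both sides. A functor is continuous if it is additive, covariant, right exact and preserves direct sums. The left $A$-action on $F(A)$ is $a\,x=F(\lambda_a)(x)$, where $\lambda_a:A_A\to A_A$ is left multiplication by $a\in A$. For $e\in\mathrm{Idemp}(A)$ let $\tau_e:eA\to A$ be the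 inclusion and $\pi_e:A\to eA$, $a\mapsto ea$, the projection. For a left $A$-module $X$ let $\gamma_{e,X}:X\to eA\otimes_AX$, $x\mapsto e\otimes_Ax$, and $\tau_{e,X}:eA\otimes_AX\to X$, $ea\otimes_Ax\mapsto eax$. Define the right $B$-linear maps $$\Upsilon_{eA}=\gamma_{e,F(A)}\circ F(\tau_e):F(eA)\to eA\otimes_AF(A),\qquad \Theta_{eA}=F(\pi_e)\circ\tau_{e,F(A)}:eA\otimes_AF(A)\to F(eA).$$ These are natural with respect to right $A$-linear maps $eA\to e'A$, $e,e'\in\mathrm{Idemp}(A)$. *)

theory Defs
  imports "HOL-Algebra.Module" "HOL-Algebra.Free_Abelian_Groups"
begin

section \<open>Rings with local units\<close>

text \<open>An associative \<open>K\<close>-algebra, not necessarily with identity. It is a library module record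
  over \<open>K\<close>; the \<open>one\<close> field of that record is never used.\<close>

locale nonunital_algebra = module K A
  for K :: "('k, 'r) ring_scheme" and A :: "('k, 'a, 's) module_scheme" (structure) +
  assumes mult_closed: "\<lbrakk>x \<in> carrier A; y \<in> carrier A\<rbrakk> \<Longrightarrow> x \<otimes> y \<in> carrier A"
    and mult_assoc: "\<lbrakk>x \<in> carrier A; y \<in> carrier A; z \<in> carrier A\<rbrakk> \<Longrightarrow>
      (x \<otimes> y) \<otimes> z = x \<otimes> (y \<otimes> z)"
    and mult_l_distr: "\<lbrakk>x \<in> carrier A; y \<in> carrier A; z \<in> carrier A\<rbrakk> \<Longrightarrow>
      (x \<oplus> y) \<otimes> z = x \<otimes> z \<oplus> y \<otimes> z"
    and mult_r_distr: "\<lbrakk>x \<in> carrier A; y \<in> carrier A; z \<in> carrier A\<rbrakk> \<Longrightarrow>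
      z \<otimes> (x \<oplus> y) = z \<otimes> x \<oplus> z \<otimes> y"
    and smult_mult_l: "\<lbrakk>k \<in> carrier K; x \<in> carrier A; y \<in> carrier A\<rbrakk> \<Longrightarrow>
      (k \<odot> x) \<otimes> y = k \<odot> (x \<otimes> y)"
    and smult_mult_r: "\<lbrakk>k \<in> carrier K; x \<in> carrier A; y \<in> carrier A\<rbrakk> \<Longrightarrow>
      x \<otimes> (k \<odot> y) = k \<odot> (x \<otimes> y)"

definition Idemp :: "('a, 's) ring_scheme \<Rightarrow> 'a set" where
  "Idemp A = {e \<in> carrier A. e \<otimes>\<^bsub>A\<^esub> e = e}"

locale ring_with_local_units = nonunital_algebra K A
  for K :: "('k, 'r) ring_scheme" and A :: "('k, 'a, 's) module_scheme" (structure) +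
  assumes local_units: "\<lbrakk>finite S; S \<subseteq> carrier A\<rbrakk> \<Longrightarrow>
    \<exists>e \<in> Idemp A. \<forall>a \<in> S. a \<otimes> e = a \<and> e \<otimes> a = a"


section \<open>The category of unital right modules\<close>

text \<open>A right module is a library module record in which \<open>a \<odot>\<^bsub>X\<^esub> x\<close> is read as the right action
  \<open>x a\<close>; hence the order reversal in \<open>ract_assoc\<close>. The \<open>mult\<close> and \<open>one\<close> fields are never used.
  There is no separate \<open>K\<close>-action: on a unital module it is the one induced from the ring.\<close>

locale right_module = abelian_group X
  for A :: "('a, 's) ring_scheme" and X :: "('a, 'm, 't) module_scheme" (structure) +
  assumes ract_closed: "\<lbrakk>a \<in> carrier A; x \<in> carrier X\<rbrakk> \<Longrightarrow> a \<odot> x \<in> carrier X"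
    and ract_add_ring: "\<lbrakk>a \<in> carrier A; b \<in> carrier A; x \<in> carrier X\<rbrakk> \<Longrightarrow>
      (a \<oplus>\<^bsub>A\<^esub> b) \<odot> x = a \<odot> x \<oplus> b \<odot> x"
    and ract_add: "\<lbrakk>a \<in> carrier A; x \<in> carrier X; y \<in> carrier X\<rbrakk> \<Longrightarrow>
      a \<odot> (x \<oplus> y) = a \<odot> x \<oplus> a \<odot> y"
    and ract_assoc: "\<lbrakk>a \<in> carrier A; b \<in> carrier A; x \<in> carrier X\<rbrakk> \<Longrightarrow>
      (a \<otimes>\<^bsub>A\<^esub> b) \<odot> x = b \<odot> (a \<odot> x)"

text \<open>\<open>X A\<close> is the additive subgroup generated by the products \<open>x a\<close>.\<close>

locale unital_right_module = right_module A X
  for A :: "('a, 's) ring_scheme" and X :: "('a, 'm, 't) module_scheme" (structure) +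
  assumes unital: "generate (add_monoid X) {a \<odot> x | a x. a \<in> carrier A \<and> x \<in> carrier X} = carrier X"

text \<open>The objects of the category of unital right \<open>A\<close>-modules with carrier inside the type \<open>'m\<close>.
  Morphisms are extensional functions, so that equality of morphisms is equality in HOL.\<close>

definition UMod :: "('a, 's) ring_scheme \<Rightarrow> ('a, 'm) module set" where
  "UMod A = {X. unital_right_module A X}"

definition mhom :: "('a, 's) ring_scheme \<Rightarrow> ('a, 'm, 't) module_scheme \<Rightarrow>
    ('a, 'n, 'u) module_scheme \<Rightarrow> ('m \<Rightarrow> 'n) set" where
  "mhom A X Y = {f \<in> carrier X \<rightarrow>\<^sub>E carrier Y.
     (\<forall>x \<in> carrier X. \<forall>y \<in> carrier X. f (x \<oplus>\<^bsub>X\<^esub> y) = f x \<oplus>\<^bsub>Y\<^esub> f y) \<and>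
     (\<forall>a \<in> carrier A. \<forall>x \<in> carrier X. f (a \<odot>\<^bsub>X\<^esub> x) = a \<odot>\<^bsub>Y\<^esub> f x)}"

definition miso :: "('a, 's) ring_scheme \<Rightarrow> ('a, 'm, 't) module_scheme \<Rightarrow>
    ('a, 'n, 'u) module_scheme \<Rightarrow> ('m \<Rightarrow> 'n) set" where
  "miso A X Y = {f \<in> mhom A X Y. bij_betw f (carrier X) (carrier Y)}"

text \<open>\<open>reg A\<close> is \<open>A\<close> as a right module over itself, and \<open>principal_mod A e\<close> is \<open>eA\<close>.\<close>

definition reg :: "('a, 's) ring_scheme \<Rightarrow> ('a, 'a) module" where
  "reg A = \<lparr>carrier = carrier A, monoid.mult = monoid.mult A, one = \<one>\<^bsub>A\<^esub>,
            ring.zero = \<zero>\<^bsub>A\<^esub>, add = ring.add A, smult = (\<lambda>a x. x \<otimes>\<^bsub>A\<^esub> a)\<rparr>"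

definition principal_mod :: "('a, 's) ring_scheme \<Rightarrow> 'a \<Rightarrow> ('a, 'a) module" where
  "principal_mod A e = (reg A)\<lparr>carrier := (\<lambda>a. e \<otimes>\<^bsub>A\<^esub> a) ` carrier A\<rparr>"

definition right_exact_seq :: "('a, 's) ring_scheme \<Rightarrow> ('a, 'm) module \<Rightarrow> ('a, 'm) module \<Rightarrow>
    ('a, 'm) module \<Rightarrow> ('m \<Rightarrow> 'm) \<Rightarrow> ('m \<Rightarrow> 'm) \<Rightarrow> bool" where
  "right_exact_seq A X Y Z f g \<longleftrightarrow>
     X \<in> UMod A \<and> Y \<in> UMod A \<and> Z \<in> UMod A \<and> f \<in> mhom A X Y \<and> g \<in> mhom A Y Z \<and>
     f ` carrier X = {y \<in> carrier Y. g y = \<zero>\<^bsub>Z\<^esub>} \<and> g ` carrier Y = carrier Z"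

text \<open>\<open>S\<close> with the maps \<open>\<iota> i\<close> is a direct sum of the \<open>X i\<close>: the canonical map from the external
  direct sum (finitely supported families) to \<open>S\<close> is an isomorphism.\<close>

definition is_direct_sum :: "('a, 's) ring_scheme \<Rightarrow> 'i set \<Rightarrow> ('i \<Rightarrow> ('a, 'm) module) \<Rightarrow>
    ('i \<Rightarrow> 'm \<Rightarrow> 'm) \<Rightarrow> ('a, 'm) module \<Rightarrow> bool" where
  "is_direct_sum A I X \<iota> S \<longleftrightarrow>
     S \<in> UMod A \<and> (\<forall>i \<in> I. X i \<in> UMod A \<and> \<iota> i \<in> mhom A (X i) S) \<and>
     (\<lambda>x. gfinprod (add_monoid S) (\<lambda>i. \<iota> i (x i)) I)
       \<in> iso (sum_group I (\<lambda>i. add_monoid (X i))) (add_monoid S)"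


section \<open>Functors\<close>

text \<open>The action on a morphism takes its source and target as arguments, since a HOL function does
  not determine its codomain module.\<close>

record ('a, 'm, 'b, 'n) mod_functor =
  fobj :: "('a, 'm) module \<Rightarrow> ('b, 'n) module"
  farr :: "('a, 'm) module \<Rightarrow> ('a, 'm) module \<Rightarrow> ('m \<Rightarrow> 'm) \<Rightarrow> 'n \<Rightarrow> 'n"

locale covariant_functor =
  fixes A :: "('a, 's) ring_scheme" and B :: "('b, 't) ring_scheme"
    and F :: "('a, 'm, 'b, 'n) mod_functor"
  assumes fobj_closed: "X \<in> UMod A \<Longrightarrow> fobj F X \<in> UMod B"
    and farr_closed: "\<lbrakk>X \<in> UMod A; Y \<in> UMod A; f \<in> mhom A X Y\<rbrakk> \<Longrightarrow>
      farr F X Y f \<in> mhom B (fobj F X) (fobj F Y)"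
    and farr_id: "X \<in> UMod A \<Longrightarrow>
      farr F X X (\<lambda>x \<in> carrier X. x) = (\<lambda>y \<in> carrier (fobj F X). y)"
    and farr_comp: "\<lbrakk>X \<in> UMod A; Y \<in> UMod A; Z \<in> UMod A; f \<in> mhom A X Y; g \<in> mhom A Y Z\<rbrakk> \<Longrightarrow>
      farr F X Z (compose (carrier X) g f)
        = compose (carrier (fobj F X)) (farr F Y Z g) (farr F X Y f)"

text \<open>Direct sums are indexed by sets in \<open>'m\<close>: when \<open>'m\<close> is infinite, these include, up to
  reindexing and zero summands, all families whose direct sum has its carrier inside \<open>'m\<close>.\<close>

locale continuous_functor = covariant_functor A B F
  for A :: "('a, 's) ring_scheme" and B :: "('b, 't) ring_scheme"
    and F :: "('a, 'm, 'b, 'n) mod_functor" +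
  assumes additive: "\<lbrakk>X \<in> UMod A; Y \<in> UMod A; f \<in> mhom A X Y; g \<in> mhom A X Y\<rbrakk> \<Longrightarrow>
      farr F X Y (\<lambda>x \<in> carrier X. f x \<oplus>\<^bsub>Y\<^esub> g x)
        = (\<lambda>z \<in> carrier (fobj F X). farr F X Y f z \<oplus>\<^bsub>fobj F Y\<^esub> farr F X Y g z)"
    and right_exact: "right_exact_seq A X Y Z f g \<Longrightarrow>
      right_exact_seq B (fobj F X) (fobj F Y) (fobj F Z) (farr F X Y f) (farr F Y Z g)"
    and preserves_direct_sums: "\<And>(I :: 'm set) X \<iota> S. is_direct_sum A I X \<iota> S \<Longrightarrow>
      is_direct_sum B I (\<lambda>i. fobj F (X i)) (\<lambda>i. farr F (X i) S (\<iota> i)) (fobj F S)"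

text \<open>Natural transformations between functors on the unital right \<open>A\<close>-modules. The two functors may
  take values in modules over different carrier types.\<close>

locale natural_trans = F: covariant_functor A B F + G: covariant_functor A B G
  for A :: "('a, 's) ring_scheme" and B :: "('b, 't) ring_scheme"
    and F :: "('a, 'm, 'b, 'n) mod_functor" and G :: "('a, 'm, 'b, 'p) mod_functor"
    and \<eta> :: "('a, 'm) module \<Rightarrow> 'n \<Rightarrow> 'p" +
  assumes extensional: "\<eta> \<in> extensional (UMod A)"
    and component: "X \<in> UMod A \<Longrightarrow> \<eta> X \<in> mhom B (fobj F X) (fobj G X)"
    and natural: "\<lbrakk>X \<in> UMod A; Y \<in> UMod A; f \<in> mhom A X Y\<rbrakk> \<Longrightarrow>
      compose (carrier (fobj F X)) (\<eta> Y) (farr F X Y f)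
        = compose (carrier (fobj F X)) (farr G X Y f) (\<eta> X)"

locale natural_iso = natural_trans A B F G \<eta>
  for A :: "('a, 's) ring_scheme" and B :: "('b, 't) ring_scheme"
    and F :: "('a, 'm, 'b, 'n) mod_functor" and G :: "('a, 'm, 'b, 'p) mod_functor"
    and \<eta> :: "('a, 'm) module \<Rightarrow> 'n \<Rightarrow> 'p" +
  assumes component_iso: "X \<in> UMod A \<Longrightarrow> \<eta> X \<in> miso B (fobj F X) (fobj G X)"


section \<open>Left modules and bimodules\<close>

text \<open>The left action is an additional field on top of a right module.\<close>

record ('a, 'b, 'm) bimodule = "('b, 'm) module" +
  lsmult :: "'a \<Rightarrow> 'm \<Rightarrow> 'm"

locale unital_left_module = abelian_group M
  for A :: "('a, 's) ring_scheme" and M :: "('a, 'b, 'm) bimodule" (structure) +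
  assumes lact_closed: "\<lbrakk>a \<in> carrier A; x \<in> carrier M\<rbrakk> \<Longrightarrow> lsmult M a x \<in> carrier M"
    and lact_add_ring: "\<lbrakk>a \<in> carrier A; b \<in> carrier A; x \<in> carrier M\<rbrakk> \<Longrightarrow>
      lsmult M (a \<oplus>\<^bsub>A\<^esub> b) x = lsmult M a x \<oplus> lsmult M b x"
    and lact_add: "\<lbrakk>a \<in> carrier A; x \<in> carrier M; y \<in> carrier M\<rbrakk> \<Longrightarrow>
      lsmult M a (x \<oplus> y) = lsmult M a x \<oplus> lsmult M a y"
    and lact_assoc: "\<lbrakk>a \<in> carrier A; b \<in> carrier A; x \<in> carrier M\<rbrakk> \<Longrightarrow>
      lsmult M (a \<otimes>\<^bsub>A\<^esub> b) x = lsmult M a (lsmult M b x)"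
    and left_unital:
      "generate (add_monoid M) {lsmult M a x | a x. a \<in> carrier A \<and> x \<in> carrier M} = carrier M"

locale unital_bimodule = left: unital_left_module A M + right: unital_right_module B M
  for A :: "('a, 's) ring_scheme" and B :: "('b, 't) ring_scheme"
    and M :: "('a, 'b, 'm) bimodule" (structure) +
  assumes actions_commute: "\<lbrakk>a \<in> carrier A; b \<in> carrier B; x \<in> carrier M\<rbrakk> \<Longrightarrow>
    b \<odot> lsmult M a x = lsmult M a (b \<odot> x)"

text \<open>\<open>F(A)\<close> with the left action \<open>a x = F(\<lambda>\<^sub>a)(x)\<close>, where \<open>\<lambda>\<^sub>a\<close> is left multiplication by \<open>a\<close>.\<close>

definition F_reg :: "('a, 's) ring_scheme \<Rightarrow> ('a, 'a, 'b, 'n) mod_functor \<Rightarrow>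
    ('a, 'b, 'n) bimodule" where
  "F_reg A F = module.extend (fobj F (reg A))
     (bimodule.fields (\<lambda>a. farr F (reg A) (reg A) (\<lambda>x \<in> carrier A. a \<otimes>\<^bsub>A\<^esub> x)))"


section \<open>Tensor products\<close>

text \<open>The tensor product of a right \<open>A\<close>-module \<open>X\<close> and a left \<open>A\<close>-module \<open>M\<close>: the free abelian group
  on \<open>X \<times> M\<close> modulo the subgroup generated by the relations of \<open>A\<close>-balanced biadditive maps.\<close>

definition tensor_relators :: "('a, 's) ring_scheme \<Rightarrow> ('a, 'm) module \<Rightarrow> ('a, 'b, 'n) bimodule \<Rightarrow>
    ('m \<times> 'n \<Rightarrow>\<^sub>0 int) set" where
  "tensor_relators A X M =
     {frag_of (x \<oplus>\<^bsub>X\<^esub> x', y) - frag_of (x, y) - frag_of (x', y) | x x' y.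
        x \<in> carrier X \<and> x' \<in> carrier X \<and> y \<in> carrier M} \<union>
     {frag_of (x, y \<oplus>\<^bsub>M\<^esub> y') - frag_of (x, y) - frag_of (x, y') | x y y'.
        x \<in> carrier X \<and> y \<in> carrier M \<and> y' \<in> carrier M} \<union>
     {frag_of (a \<odot>\<^bsub>X\<^esub> x, y) - frag_of (x, lsmult M a y) | a x y.
        a \<in> carrier A \<and> x \<in> carrier X \<and> y \<in> carrier M}"

definition tensor_free :: "('a, 'm) module \<Rightarrow> ('a, 'b, 'n) bimodule \<Rightarrow>
    ('m \<times> 'n \<Rightarrow>\<^sub>0 int) monoid" where
  "tensor_free X M = free_Abelian_group (carrier X \<times> carrier M)"

definition tensor_null :: "('a, 's) ring_scheme \<Rightarrow> ('a, 'm) module \<Rightarrow> ('a, 'b, 'n) bimodule \<Rightarrow>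
    ('m \<times> 'n \<Rightarrow>\<^sub>0 int) set" where
  "tensor_null A X M = generate (tensor_free X M) (tensor_relators A X M)"

text \<open>The underlying additive group; the multiplicative fields of the record are irrelevant.\<close>

definition tensor_ag :: "('a, 's) ring_scheme \<Rightarrow> ('a, 'm) module \<Rightarrow> ('a, 'b, 'n) bimodule \<Rightarrow>
    ('m \<times> 'n \<Rightarrow>\<^sub>0 int) set ring" where
  "tensor_ag A X M = (let Q = tensor_free X M Mod tensor_null A X M in
     \<lparr>carrier = carrier Q, monoid.mult = undefined, one = undefined,
      ring.zero = \<one>\<^bsub>Q\<^esub>, add = monoid.mult Q\<rparr>)"

definition pure_tensor :: "('a, 's) ring_scheme \<Rightarrow> ('a, 'm) module \<Rightarrow> ('a, 'b, 'n) bimodule \<Rightarrow>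
    'm \<Rightarrow> 'n \<Rightarrow> ('m \<times> 'n \<Rightarrow>\<^sub>0 int) set" where
  "pure_tensor A X M x y = tensor_null A X M #>\<^bsub>tensor_free X M\<^esub> frag_of (x, y)"

text \<open>The additive map out of the tensor product sending \<open>x \<otimes> y\<close> to \<open>\<beta> x y\<close>, for \<open>A\<close>-balanced
  biadditive \<open>\<beta>\<close>: a formal sum is evaluated in \<open>Z\<close>, and the value on a coset is the common value
  on its members.\<close>

definition tensor_lift :: "('a, 's) ring_scheme \<Rightarrow> ('a, 'm) module \<Rightarrow> ('a, 'b, 'n) bimodule \<Rightarrow>
    ('z, 't) ring_scheme \<Rightarrow> ('m \<Rightarrow> 'n \<Rightarrow> 'z) \<Rightarrow> ('m \<times> 'n \<Rightarrow>\<^sub>0 int) set \<Rightarrow> 'z" where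
  "tensor_lift A X M Z \<beta> = (\<lambda>C \<in> carrier (tensor_ag A X M). the_elem
     ((\<lambda>c. \<Oplus>\<^bsub>Z\<^esub>p \<in> Poly_Mapping.keys c. [Poly_Mapping.lookup c p] \<cdot>\<^bsub>Z\<^esub> \<beta> (fst p) (snd p)) ` C))"

text \<open>The right \<open>B\<close>-action is \<open>(x \<otimes> y) b = x \<otimes> (y b)\<close>.\<close>

definition tensor :: "('a, 's) ring_scheme \<Rightarrow> ('a, 'm) module \<Rightarrow> ('a, 'b, 'n) bimodule \<Rightarrow>
    ('b, ('m \<times> 'n \<Rightarrow>\<^sub>0 int) set) module" where
  "tensor A X M = ring.extend (tensor_ag A X M)
     (module.fields
       (\<lambda>b. tensor_lift A X M (tensor_ag A X M) (\<lambda>x y. pure_tensor A X M x (b \<odot>\<^bsub>M\<^esub> y))))"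

text \<open>The functor \<open>- \<otimes>\<^sub>A M\<close>.\<close>

definition tensor_functor :: "('a, 's) ring_scheme \<Rightarrow> ('a, 'b, 'n) bimodule \<Rightarrow>
    ('a, 'm, 'b, ('m \<times> 'n \<Rightarrow>\<^sub>0 int) set) mod_functor" where
  "tensor_functor A M =
     \<lparr>fobj = (\<lambda>X. tensor A X M),
      farr = (\<lambda>X Y f. tensor_lift A X M (tensor_ag A Y M) (\<lambda>x y. pure_tensor A Y M (f x) y))\<rparr>"


section \<open>The maps \<open>\<Upsilon>\<close> and \<open>\<Theta>\<close>\<close>

text \<open>In this order: \<open>\<tau>\<^sub>e\<close>, \<open>\<pi>\<^sub>e\<close>, \<open>x \<mapsto> e \<otimes> x\<close> (written \<open>\<gamma>\<close> with subscripts \<open>e, M\<close>), and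
  \<open>u \<otimes> x \<mapsto> u x\<close> for \<open>u \<in> eA\<close> (written \<open>\<tau>\<close> with subscripts \<open>e, M\<close>).\<close>

definition incl :: "('a, 's) ring_scheme \<Rightarrow> 'a \<Rightarrow> 'a \<Rightarrow> 'a" where
  "incl A e = (\<lambda>x \<in> carrier (principal_mod A e). x)"

definition proj :: "('a, 's) ring_scheme \<Rightarrow> 'a \<Rightarrow> 'a \<Rightarrow> 'a" where
  "proj A e = (\<lambda>a \<in> carrier A. e \<otimes>\<^bsub>A\<^esub> a)"

definition tens_in :: "('a, 's) ring_scheme \<Rightarrow> ('a, 'b, 'n) bimodule \<Rightarrow> 'a \<Rightarrow>
    'n \<Rightarrow> ('a \<times> 'n \<Rightarrow>\<^sub>0 int) set" where
  "tens_in A M e = (\<lambda>x \<in> carrier M. pure_tensor A (principal_mod A e) M e x)"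

definition tens_out :: "('a, 's) ring_scheme \<Rightarrow> ('a, 'b, 'n) bimodule \<Rightarrow> 'a \<Rightarrow>
    ('a \<times> 'n \<Rightarrow>\<^sub>0 int) set \<Rightarrow> 'n" where
  "tens_out A M e = tensor_lift A (principal_mod A e) M M (\<lambda>u x. lsmult M u x)"

definition Upsilon :: "('a, 's) ring_scheme \<Rightarrow> ('a, 'a, 'b, 'n) mod_functor \<Rightarrow> 'a \<Rightarrow>
    'n \<Rightarrow> ('a \<times> 'n \<Rightarrow>\<^sub>0 int) set" where
  "Upsilon A F e = compose (carrier (fobj F (principal_mod A e)))
     (tens_in A (F_reg A F) e) (farr F (principal_mod A e) (reg A) (incl A e))"

definition Theta :: "('a, 's) ring_scheme \<Rightarrow> ('a, 'a, 'b, 'n) mod_functor \<Rightarrow> 'a \<Rightarrow>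
    ('a \<times> 'n \<Rightarrow>\<^sub>0 int) set \<Rightarrow> 'n" where
  "Theta A F e = compose (carrier (tensor A (principal_mod A e) (F_reg A F)))
     (farr F (reg A) (principal_mod A e) (proj A e)) (tens_out A (F_reg A F) e)"

end

theory Submission imports Defs begin

text \<open>For a unital right module \<open>X\<close> and \<open>x \<in> X\<close> let \<open>\<phi>\<^sub>x : A \<rightarrow> X\<close> be the map \<open>a \<mapsto> x a\<close>. The formula
  \<open>x \<otimes> y \<mapsto> F(\<phi>\<^sub>x)(y)\<close> defines a natural \<open>B\<close>-linear map \<open>\<Theta>\<^sub>X : X \<otimes>\<^sub>A F(A) \<rightarrow> F(X)\<close> for every \<open>X\<close>,
  which for \<open>X = eA\<close> is the given one, with inverse \<open>\<Upsilon>\<close>. Since \<open>X\<close> is a quotient of a direct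
  sum \<open>P\<close> of modules \<open>eA\<close>, the module \<open>F(X)\<close> is generated by the images of the \<open>F(\<phi>\<^sub>x)\<close>. This gives left
  unitality of \<open>F(A)\<close>, surjectivity of all \<open>\<Theta>\<^sub>X\<close>, and uniqueness of the extension of \<open>\<Upsilon>\<close>. As \<open>F\<close>
  preserves direct sums, \<open>\<Theta>\<^sub>P\<close> has a left inverse, and a diagram chase along \<open>Q \<rightarrow> P \<rightarrow> X \<rightarrow> 0\<close>, with \<open>Q\<close>
  the kernel, then shows that \<open>\<Theta>\<^sub>X\<close> is injective; the chase needs surjectivity of \<open>\<Theta>\<^sub>Q\<close> but not right
  exactness of the tensor product.\<close>

section \<open>Unital modules and their homomorphisms\<close>

text \<open>The formula for \<Theta> on \<open>x \<otimes> y\<close> involves no choice, whereas its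
  inverse has an explicit formula only on the modules \<open>eA\<close>; hence \<Theta> is the map
  that gets extended. Its properties are functoriality of \<open>F\<close> applied to identities
  between orbit maps: the orbit map of \<open>f x\<close> is that of \<open>x\<close> followed by
  \<open>f\<close>, which gives naturality, and the special case where \<open>f\<close> is itself an
  orbit map gives balancing. Additivity in \<open>x\<close> is additivity of \<open>F\<close>. Two
  obstacles shape the rest. \<open>A\<close> need not have an identity, so the modules
  \<open>eA\<close> take the place of free modules, with \<open>e\<close> chosen separately for each
  \<open>x\<close> such that \<open>x e = x\<close>. And \<open>F\<close> is given only on modules
  whose carrier lies in one fixed type, so the cover \<open>P\<close> must be realised inside that
  type, which forces a cardinality argument. Left unitality of \<open>F(A)\<close> is both a claim
  and a precondition of the results on tensor products used here, so generation of
  \<open>F(X)\<close> has to be obtained from \<open>F\<close> alone, before any tensor product with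
  \<open>F(A)\<close>.\<close>

lemma group_hom_eq_on_generate:
  assumes "group_hom G H f" and "group_hom G H g"
    and "S \<subseteq> carrier G" and "\<And>s. s \<in> S \<Longrightarrow> f s = g s" and "x \<in> generate G S"
  shows "f x = g x"
proof -
  interpret f: group_hom G H f by fact
  interpret g: group_hom G H g by fact
  have *: "\<And>y. y \<in> generate G S \<Longrightarrow> y \<in> carrier G"
    using assms(3) by (rule f.G.generate_in_carrier)
  from assms(5) show ?thesis
  proof (induct x rule: generate.induct)
    case (inv h)
    then show ?case using assms(3,4) by (metis f.hom_inv g.hom_inv subsetD)
  next
    case (eng h1 h2)
    then show ?case using * by simp
  qed (use assms(4) in auto)
qed

lemma add_group_homI:
  assumes "abelian_group X" "abelian_group Y" "f \<in> hom (add_monoid X) (add_monoid Y)"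
  shows "group_hom (add_monoid X) (add_monoid Y) f"
  using assms by (simp add: group_hom_def group_hom_axioms_def abelian_group.a_group)

lemma add_hom_zero:
  assumes "abelian_group X" "abelian_group Y" "f \<in> hom (add_monoid X) (add_monoid Y)"
  shows "f \<zero>\<^bsub>X\<^esub> = \<zero>\<^bsub>Y\<^esub>"
  using group_hom.hom_one[OF add_group_homI[OF assms]] by simp

lemma add_hom_eqI:
  assumes "abelian_group X" "abelian_group Y"
    and "f \<in> hom (add_monoid X) (add_monoid Y)" "g \<in> hom (add_monoid X) (add_monoid Y)"
    and "generate (add_monoid X) S = carrier X"
    and "\<And>s. s \<in> S \<Longrightarrow> f s = g s" and "x \<in> carrier X"
  shows "f x = g x"
proof -
  have "S \<subseteq> carrier X" using assms(5) generate.incl by (metis subsetI)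
  then show ?thesis
    using group_hom_eq_on_generate[OF add_group_homI[OF assms(1,2,3)] add_group_homI[OF assms(1,2,4)], of S x]
      assms(5-7) by simp
qed

lemma add_hom_surjI:
  assumes "abelian_group X" "abelian_group Y"
    and "f \<in> hom (add_monoid X) (add_monoid Y)"
    and "generate (add_monoid Y) S = carrier Y" and "S \<subseteq> f ` carrier X"
  shows "f ` carrier X = carrier Y"
proof -
  interpret group_hom "add_monoid X" "add_monoid Y" f by (rule add_group_homI[OF assms(1-3)])
  show ?thesis
    using H.generate_subgroup_incl[OF _ img_is_subgroup, of S] assms(4,5) hom_closed by auto
qed

lemma add_hom_injI:
  assumes "abelian_group X" "abelian_group Y"
    and "f \<in> hom (add_monoid X) (add_monoid Y)"
    and "\<And>x. \<lbrakk>x \<in> carrier X; f x = \<zero>\<^bsub>Y\<^esub>\<rbrakk> \<Longrightarrow> x = \<zero>\<^bsub>X\<^esub>"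
  shows "inj_on f (carrier X)"
proof -
  interpret group_hom "add_monoid X" "add_monoid Y" f by (rule add_group_homI[OF assms(1-3)])
  show ?thesis using inj_on_one_iff assms(4) by simp
qed

lemma mhom_closed: "f \<in> mhom A X Y \<Longrightarrow> x \<in> carrier X \<Longrightarrow> f x \<in> carrier Y"
  and mhom_add: "f \<in> mhom A X Y \<Longrightarrow> x \<in> carrier X \<Longrightarrow> y \<in> carrier X \<Longrightarrow> f (x \<oplus>\<^bsub>X\<^esub> y) = f x \<oplus>\<^bsub>Y\<^esub> f y"
  and mhom_ract: "f \<in> mhom A X Y \<Longrightarrow> a \<in> carrier A \<Longrightarrow> x \<in> carrier X \<Longrightarrow> f (a \<odot>\<^bsub>X\<^esub> x) = a \<odot>\<^bsub>Y\<^esub> f x"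
  and mhom_extensional: "f \<in> mhom A X Y \<Longrightarrow> f \<in> extensional (carrier X)"
  by (auto simp: mhom_def PiE_def)

lemma mhom_hom: "f \<in> mhom A X Y \<Longrightarrow> f \<in> hom (add_monoid X) (add_monoid Y)"
  by (auto simp: hom_def mhom_closed mhom_add)

lemma mhomI:
  assumes "f \<in> extensional (carrier X)" "f \<in> hom (add_monoid X) (add_monoid Y)"
    and "\<And>a x. a \<in> carrier A \<Longrightarrow> x \<in> carrier X \<Longrightarrow> f (a \<odot>\<^bsub>X\<^esub> x) = a \<odot>\<^bsub>Y\<^esub> f x"
  shows "f \<in> mhom A X Y"
  using assms by (auto simp: mhom_def hom_def PiE_def)

lemma mhom_eqI:
  assumes "f \<in> mhom A X Y" "g \<in> mhom A X Y'" "\<And>x. x \<in> carrier X \<Longrightarrow> f x = g x"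
  shows "f = g"
  using assms by (meson extensionalityI mhom_extensional)

lemma (in right_module) mhom_compose:
  assumes "f \<in> mhom A X Y" "g \<in> mhom A Y Z"
  shows "compose (carrier X) g f \<in> mhom A X Z"
  using assms
  by (intro mhomI) (auto simp: hom_def compose_def mhom_closed mhom_add mhom_ract ract_closed)

lemma (in right_module) mhom_id: "(\<lambda>x \<in> carrier X. x) \<in> mhom A X X"
  by (auto simp: mhom_def ract_closed)

lemma (in right_module) ract_hom:
  "a \<in> carrier A \<Longrightarrow> (\<lambda>x. a \<odot> x) \<in> hom (add_monoid X) (add_monoid X)"
  by (auto simp: hom_def ract_closed ract_add)

lemma (in right_module) ract_minus:
  assumes "a \<in> carrier A" "x \<in> carrier X"
  shows "a \<odot> (\<ominus> x) = \<ominus> (a \<odot> x)"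
  using group_hom.hom_inv[OF add_group_homI[OF abelian_group_axioms abelian_group_axioms ract_hom]] assms
  by (simp add: a_inv_def)

lemma (in right_module) ract_zero: "a \<in> carrier A \<Longrightarrow> a \<odot> \<zero> = \<zero>"
  using add_hom_zero[OF abelian_group_axioms abelian_group_axioms ract_hom] by simp

text \<open>Serves two constructions: \<open>eA\<close> as the image of left multiplication by
  \<open>e\<close>, and the kernel \<open>Q\<close> of the cover.\<close>

lemma (in right_module) restrict_right_module:
  assumes "subgroup H (add_monoid X)" "\<And>a x. a \<in> carrier A \<Longrightarrow> x \<in> H \<Longrightarrow> a \<odot> x \<in> H"
  shows "right_module A (X\<lparr>carrier := H\<rparr>)"
proof -
  interpret H: subgroup H "add_monoid X" by fact
  have sub: "H \<subseteq> carrier X" using H.subset by simp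
  have ag: "abelian_group (X\<lparr>carrier := H\<rparr>)"
  proof (rule abelian_groupI, goal_cases)
    case (1 x y)
    then show ?case using H.m_closed by simp
  next
    case 2
    then show ?case using H.one_closed by simp
  next
    case (3 x y z)
    then show ?case using sub by (simp add: a_assoc subset_iff)
  next
    case (4 x y)
    then show ?case using sub by (simp add: a_comm subset_iff)
  next
    case (5 x)
    then show ?case using sub by (simp add: subset_iff)
  next
    case (6 x)
    then have "\<ominus> x \<in> H" "\<ominus> x \<oplus> x = \<zero>"
      using H.m_inv_closed[of x] sub by (simp_all add: a_inv_def[symmetric] l_neg subset_iff)
    then show ?case by auto
  qed
  show ?thesis
    using assms(2) sub
    by (auto simp: right_module_def right_module_axioms_def ag ract_add_ring ract_add ract_assoc subset_iff)
qed

section \<open>Unitality and local units of single elements\<close>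

lemma (in nonunital_algebra) Idemp_closed: "e \<in> Idemp A \<Longrightarrow> e \<in> carrier A"
  by (simp add: Idemp_def)

lemma (in ring_with_local_units) unitalI:
  assumes "right_module A X" "\<And>x. x \<in> carrier X \<Longrightarrow> \<exists>a \<in> carrier A. a \<odot>\<^bsub>X\<^esub> x = x"
  shows "unital_right_module A X"
proof -
  interpret X: right_module A X by fact
  let ?S = "{a \<odot>\<^bsub>X\<^esub> x | a x. a \<in> carrier A \<and> x \<in> carrier X}"
  have "carrier X \<subseteq> ?S" using assms(2) by force
  moreover have S: "?S \<subseteq> carrier X" using X.ract_closed by auto
  ultimately have "generate (add_monoid X) ?S = carrier X"
    using X.add.generate_incl[of ?S] generate.incl[of _ ?S "add_monoid X"] by blast
  then show ?thesis by unfold_locales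
qed

text \<open>The elements fixed by some idempotent include all products \<open>x a\<close> and are
  closed under sums: the idempotents \<open>e\<close>, \<open>f\<close> of two summands have a
  common local unit \<open>g\<close>, and \<open>e g = e\<close>, \<open>f g = f\<close> make
  \<open>g\<close> fix both. Together with \<open>unitalI\<close> this trades the generated subgroup
  in the definition of unitality for an elementwise condition.\<close>

lemma (in ring_with_local_units) local_unit_module:
  assumes "unital_right_module A X" "x \<in> carrier X"
  shows "\<exists>e \<in> Idemp A. e \<odot>\<^bsub>X\<^esub> x = x"
proof -
  interpret X: unital_right_module A X by fact
  let ?S = "{a \<odot>\<^bsub>X\<^esub> x | a x. a \<in> carrier A \<and> x \<in> carrier X}"
  have S: "?S \<subseteq> carrier X" using X.ract_closed by auto
  have unit: "\<exists>e \<in> Idemp A. e \<odot>\<^bsub>X\<^esub> h = h" if "h \<in> ?S" for h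
  proof -
    from that obtain a x where h: "h = a \<odot>\<^bsub>X\<^esub> x" "a \<in> carrier A" "x \<in> carrier X" by auto
    then obtain e where e: "e \<in> Idemp A" "a \<otimes> e = a" using local_units[of "{a}"] by auto
    have "e \<odot>\<^bsub>X\<^esub> h = h"
      using X.ract_assoc[of a e x] h e Idemp_closed by metis
    then show ?thesis using e(1) by blast
  qed
  have "x \<in> generate (add_monoid X) ?S" using assms X.unital by simp
  then show ?thesis
  proof (induct x rule: generate.induct)
    case one
    \<comment> \<open>The empty set has a local unit too, so some idempotent exists, and every
      idempotent fixes zero.\<close>
    then show ?case using local_units[of "{}"] X.ract_zero Idemp_closed by auto
  next
    case (inv h)
    then obtain e where "e \<in> Idemp A" "e \<odot>\<^bsub>X\<^esub> h = h" using unit by blast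
    then show ?case using inv S X.ract_minus[of e h] Idemp_closed
      by (intro bexI[of _ e]) (auto simp flip: a_inv_def)
  next
    case (eng h1 h2)
    have hc: "h1 \<in> carrier X" "h2 \<in> carrier X"
      using eng(1,3) X.add.generate_in_carrier[OF S] by auto
    obtain e f where ef: "e \<in> Idemp A" "e \<odot>\<^bsub>X\<^esub> h1 = h1" "f \<in> Idemp A" "f \<odot>\<^bsub>X\<^esub> h2 = h2"
      using eng by auto
    then obtain g where g: "g \<in> Idemp A" "e \<otimes> g = e" "f \<otimes> g = f"
      using local_units[of "{e, f}"] Idemp_closed by auto
    note c = ef(1)[THEN Idemp_closed] ef(3)[THEN Idemp_closed] g(1)[THEN Idemp_closed]
    have "g \<odot>\<^bsub>X\<^esub> (e \<odot>\<^bsub>X\<^esub> h1) = e \<odot>\<^bsub>X\<^esub> h1" "g \<odot>\<^bsub>X\<^esub> (f \<odot>\<^bsub>X\<^esub> h2) = f \<odot>\<^bsub>X\<^esub> h2"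
      using X.ract_assoc[of e g h1] X.ract_assoc[of f g h2] c hc g by metis+
    then show ?case using g(1) hc ef c X.ract_add[of g h1 h2] by (intro bexI[of _ g]) auto
  qed (use unit in blast)
qed

lemma UModD: "X \<in> UMod A \<Longrightarrow> unital_right_module A X"
  by (simp add: UMod_def)

lemma UMod_right_module: "X \<in> UMod A \<Longrightarrow> right_module A X"
  by (simp add: UMod_def unital_right_module_def)

lemma UMod_abelian: "X \<in> UMod A \<Longrightarrow> abelian_group X"
  by (simp add: UMod_def unital_right_module_def right_module_def)

text \<open>The map \<open>\<phi>\<^sub>x\<close> of the overview. On the regular module it is left
  multiplication by \<open>x\<close>, so the left action on \<open>F(A)\<close> is itself the image
  of an orbit map under \<open>F\<close>.\<close>

definition orbit_map :: "('a, 's) ring_scheme \<Rightarrow> ('a, 'm, 't) module_scheme \<Rightarrow> 'm \<Rightarrow> 'a \<Rightarrow> 'm" where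
  "orbit_map A X x = (\<lambda>a \<in> carrier A. a \<odot>\<^bsub>X\<^esub> x)"

section \<open>The regular module and the modules \<open>eA\<close>\<close>

lemma carrier_reg [simp]: "carrier (reg A) = carrier A"
  and zero_reg [simp]: "\<zero>\<^bsub>reg A\<^esub> = \<zero>\<^bsub>A\<^esub>"
  and add_reg [simp]: "add (reg A) = add A"
  and smult_reg [simp]: "a \<odot>\<^bsub>reg A\<^esub> x = x \<otimes>\<^bsub>A\<^esub> a"
  by (simp_all add: reg_def)

lemma carrier_principal_mod [simp]: "carrier (principal_mod A e) = (\<lambda>a. e \<otimes>\<^bsub>A\<^esub> a) ` carrier A"
  and zero_principal_mod [simp]: "\<zero>\<^bsub>principal_mod A e\<^esub> = \<zero>\<^bsub>A\<^esub>"
  and add_principal_mod [simp]: "add (principal_mod A e) = add A"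
  and smult_principal_mod [simp]: "a \<odot>\<^bsub>principal_mod A e\<^esub> x = x \<otimes>\<^bsub>A\<^esub> a"
  by (simp_all add: principal_mod_def)

lemma (in ring_with_local_units) reg_UMod: "reg A \<in> UMod A"
proof -
  have "abelian_group (reg A)"
    by (rule abelian_groupI) (use a_assoc a_comm l_neg a_inv_closed in auto)
  then have "right_module A (reg A)"
    by (auto simp: right_module_def right_module_axioms_def mult_closed mult_assoc mult_l_distr mult_r_distr)
  then show ?thesis
    unfolding UMod_def
  proof (intro CollectI unitalI)
    fix x assume "x \<in> carrier (reg A)"
    then show "\<exists>a\<in>carrier A. a \<odot>\<^bsub>reg A\<^esub> x = x"
      using local_units[of "{x}"] Idemp_closed by auto
  qed
qed

text \<open>Idempotence makes the image of left multiplication by \<open>e\<close> its fixed point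
  set. Later arguments prefer this form to the image, hence the frequent removal of
  \<open>carrier_principal_mod\<close> from the simpset.\<close>

lemma (in ring_with_local_units) principal_mod_iff:
  assumes "e \<in> Idemp A"
  shows "x \<in> carrier (principal_mod A e) \<longleftrightarrow> x \<in> carrier A \<and> e \<otimes> x = x"
proof
  assume "x \<in> carrier (principal_mod A e)"
  then obtain a where "x = e \<otimes> a" "a \<in> carrier A" by auto
  then show "x \<in> carrier A \<and> e \<otimes> x = x"
    using assms mult_assoc[of e e a, symmetric] by (simp add: Idemp_def mult_closed)
qed (auto intro: image_eqI[of x _ x])

lemma (in ring_with_local_units) principal_mod_UMod:
  assumes e: "e \<in> Idemp A"
  shows "principal_mod A e \<in> UMod A"
proof -
  interpret R: right_module A "reg A" by (rule UMod_right_module[OF reg_UMod])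
  note iff = principal_mod_iff[OF e, unfolded carrier_principal_mod]
  note ec = Idemp_closed[OF e]
  let ?H = "(\<lambda>a. e \<otimes> a) ` carrier A"
  have "group_hom (add_monoid (reg A)) (add_monoid (reg A)) (\<lambda>a. e \<otimes> a)"
    by (rule add_group_homI) (use R.abelian_group_axioms ec in \<open>auto simp: hom_def mult_closed mult_r_distr\<close>)
  from group_hom.img_is_subgroup[OF this]
  have "subgroup ?H (add_monoid (reg A))" by simp
  then have rm: "right_module A (principal_mod A e)"
    unfolding principal_mod_def
    by (rule R.restrict_right_module) (use ec mult_assoc mult_closed in auto)
  show ?thesis
    unfolding UMod_def
  proof (rule CollectI, rule unitalI[OF rm])
    \<comment> \<open>On \<open>eA\<close> the idempotent \<open>e\<close> is a unit from the left;
      a unit for \<open>x\<close> from the right is supplied by the local units of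
      \<open>A\<close>.\<close>
    fix x assume "x \<in> carrier (principal_mod A e)"
    then have "x \<in> carrier A" using iff by auto
    then show "\<exists>a\<in>carrier A. a \<odot>\<^bsub>principal_mod A e\<^esub> x = x"
      using local_units[of "{x}"] Idemp_closed by auto
  qed
qed

lemma (in ring_with_local_units) Idemp_in_principal_mod:
  "e \<in> Idemp A \<Longrightarrow> e \<in> carrier (principal_mod A e)"
  by (simp only: principal_mod_iff) (simp add: Idemp_def)

lemma (in ring_with_local_units) incl_mhom:
  assumes e: "e \<in> Idemp A"
  shows "incl A e \<in> mhom A (principal_mod A e) (reg A)"
proof -
  interpret P: right_module A "principal_mod A e"
    by (rule UMod_right_module[OF principal_mod_UMod[OF e]])
  show ?thesis
    using P.a_closed P.ract_closed principal_mod_iff[OF e]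
    by (auto simp: mhom_def incl_def simp del: carrier_principal_mod)
qed

lemma (in ring_with_local_units) proj_mhom:
  "e \<in> Idemp A \<Longrightarrow> proj A e \<in> mhom A (reg A) (principal_mod A e)"
  using Idemp_closed[of e]
  by (auto simp: mhom_def proj_def mult_closed mult_assoc mult_r_distr)

lemma (in ring_with_local_units) orbit_map_mhom:
  assumes "right_module A X" "x \<in> carrier X"
  shows "orbit_map A X x \<in> mhom A (reg A) X"
proof -
  interpret X: right_module A X by fact
  show ?thesis using assms(2)
    by (auto simp: mhom_def orbit_map_def X.ract_closed X.ract_add_ring X.ract_assoc mult_closed)
qed

lemma (in ring_with_local_units) compose_orbit_map:
  assumes "right_module A X" "f \<in> mhom A X Y" "x \<in> carrier X"
  shows "compose (carrier (reg A)) f (orbit_map A X x) = orbit_map A Y (f x)"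
  using assms by (auto simp: compose_def orbit_map_def mhom_ract fun_eq_iff)

section \<open>The universal property of the tensor product\<close>

text \<open>Unitality of \<open>M\<close> is built in, so the left unitality of \<open>F(A)\<close>
  has to be established before these results apply to it.\<close>

locale tensor_pair = X: right_module A X + M: unital_left_module A M
  for A :: "('a, 's) ring_scheme" and X :: "('a, 'm) module" and M :: "('a, 'b, 'n) bimodule"
begin

abbreviation "Fr \<equiv> tensor_free X M"
abbreviation "N \<equiv> tensor_null A X M"
abbreviation "T \<equiv> tensor_ag A X M"
abbreviation "pure \<equiv> pure_tensor A X M"

definition cls :: "('m \<times> 'n \<Rightarrow>\<^sub>0 int) \<Rightarrow> ('m \<times> 'n \<Rightarrow>\<^sub>0 int) set" where
  "cls c = N #>\<^bsub>Fr\<^esub> c"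

sublocale Fr: comm_group Fr
  by (simp add: tensor_free_def abelian_free_Abelian_group)

lemma carrier_Fr: "c \<in> carrier Fr \<longleftrightarrow> Poly_Mapping.keys c \<subseteq> carrier X \<times> carrier M"
  and mult_Fr: "c \<otimes>\<^bsub>Fr\<^esub> d = c + d"
  and one_Fr: "\<one>\<^bsub>Fr\<^esub> = 0"
  by (simp_all add: tensor_free_def)

lemma frag_of_Fr: "x \<in> carrier X \<Longrightarrow> y \<in> carrier M \<Longrightarrow> frag_of (x, y) \<in> carrier Fr"
  by (simp add: carrier_Fr keys_frag_of)

lemma diff_Fr: "c \<in> carrier Fr \<Longrightarrow> d \<in> carrier Fr \<Longrightarrow> c - d \<in> carrier Fr"
  using keys_diff[of c d] by (auto simp: carrier_Fr)

lemma relators_Fr: "tensor_relators A X M \<subseteq> carrier Fr"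
  unfolding tensor_relators_def
  using X.ract_closed M.lact_closed by (auto intro!: diff_Fr frag_of_Fr)

lemma N_subgroup: "subgroup N Fr"
  unfolding tensor_null_def by (rule Fr.generate_is_subgroup[OF relators_Fr])

lemma N_normal: "N \<lhd> Fr"
  using N_subgroup by (simp add: Fr.normal_iff_subgroup)

lemma T_simps:
  "carrier T = carrier (Fr Mod N)" "\<zero>\<^bsub>T\<^esub> = \<one>\<^bsub>Fr Mod N\<^esub>" "add T = monoid.mult (Fr Mod N)"
  by (simp_all add: tensor_ag_def Let_def)

lemma T_abelian: "abelian_group T"
proof -
  interpret Q: comm_group "Fr Mod N" by (rule Fr.abelian_FactGroup[OF N_subgroup])
  show ?thesis
    by (rule abelian_groupI; unfold T_simps)
      (rule Q.m_closed Q.one_closed Q.m_assoc Q.m_comm Q.l_one Q.l_inv_ex; assumption)+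
qed

sublocale T: abelian_group T by (rule T_abelian)

lemma cls_hom: "cls \<in> hom Fr (add_monoid T)"
  using normal.r_coset_hom_Mod[OF N_normal] unfolding hom_def T_simps by (simp add: cls_def Pi_def)

sublocale cls: group_hom Fr "add_monoid T" cls
  by (intro group_hom.intro group_hom_axioms.intro cls_hom T.a_group Fr.group_axioms)

lemma cls_surj: "cls ` carrier Fr = carrier T"
  by (auto simp: T_simps cls_def FactGroup_def RCOSETS_def)

lemma pure_cls: "pure x y = cls (frag_of (x, y))"
  by (simp add: pure_tensor_def cls_def)

lemma cls_relator:
  assumes "r \<in> tensor_relators A X M"
  shows "cls r = \<zero>\<^bsub>T\<^esub>"
proof -
  have "r \<in> N" using assms unfolding tensor_null_def by (rule generate.incl)
  then show ?thesis
    using Fr.coset_join2[OF _ N_subgroup] relators_Fr assms by (auto simp: cls_def T_simps)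
qed

text \<open>Write \<open>c = (c - d) + d\<close>: the first summand has class zero. Each identity
  between tensors is thus reduced to recognising a difference as a relator.\<close>

lemma cls_diff_relator:
  assumes "c - d \<in> tensor_relators A X M" "d \<in> carrier Fr"
  shows "cls c = cls d"
proof -
  have r: "c - d \<in> carrier Fr" using assms(1) relators_Fr by blast
  have "cls (c - d + d) = cls (c - d) \<oplus>\<^bsub>T\<^esub> cls d"
    using cls.hom_mult[OF r assms(2)] by (simp add: mult_Fr)
  then show ?thesis
    using cls_relator[OF assms(1)] cls.hom_closed[OF assms(2)] by simp
qed

lemma pure_closed: "\<lbrakk>x \<in> carrier X; y \<in> carrier M\<rbrakk> \<Longrightarrow> pure x y \<in> carrier T"
  using cls.hom_closed[OF frag_of_Fr] by (simp add: pure_cls)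

lemma pure_add_left:
  assumes "x \<in> carrier X" "x' \<in> carrier X" "y \<in> carrier M"
  shows "pure (x \<oplus>\<^bsub>X\<^esub> x') y = pure x y \<oplus>\<^bsub>T\<^esub> pure x' y"
proof -
  have "pure (x \<oplus>\<^bsub>X\<^esub> x') y = cls (frag_of (x, y) + frag_of (x', y))"
    unfolding pure_cls
  proof (rule cls_diff_relator)
    show "frag_of (x \<oplus>\<^bsub>X\<^esub> x', y) - (frag_of (x, y) + frag_of (x', y)) \<in> tensor_relators A X M"
      using assms unfolding tensor_relators_def diff_diff_add[symmetric] by blast
  qed (use Fr.m_closed[OF frag_of_Fr[OF assms(1,3)] frag_of_Fr[OF assms(2,3)]] in \<open>simp add: mult_Fr\<close>)
  then show ?thesis
    using cls.hom_mult[OF frag_of_Fr[OF assms(1,3)] frag_of_Fr[OF assms(2,3)]]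
    by (simp add: mult_Fr pure_cls)
qed

lemma pure_add_right:
  assumes "x \<in> carrier X" "y \<in> carrier M" "y' \<in> carrier M"
  shows "pure x (y \<oplus>\<^bsub>M\<^esub> y') = pure x y \<oplus>\<^bsub>T\<^esub> pure x y'"
proof -
  have "pure x (y \<oplus>\<^bsub>M\<^esub> y') = cls (frag_of (x, y) + frag_of (x, y'))"
    unfolding pure_cls
  proof (rule cls_diff_relator)
    show "frag_of (x, y \<oplus>\<^bsub>M\<^esub> y') - (frag_of (x, y) + frag_of (x, y')) \<in> tensor_relators A X M"
      using assms unfolding tensor_relators_def diff_diff_add[symmetric] by blast
  qed (use Fr.m_closed[OF frag_of_Fr[OF assms(1,2)] frag_of_Fr[OF assms(1,3)]] in \<open>simp add: mult_Fr\<close>)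
  then show ?thesis
    using cls.hom_mult[OF frag_of_Fr[OF assms(1,2)] frag_of_Fr[OF assms(1,3)]]
    by (simp add: mult_Fr pure_cls)
qed

lemma pure_balanced:
  assumes "a \<in> carrier A" "x \<in> carrier X" "y \<in> carrier M"
  shows "pure (a \<odot>\<^bsub>X\<^esub> x) y = pure x (lsmult M a y)"
  unfolding pure_cls
proof (rule cls_diff_relator)
  show "frag_of (a \<odot>\<^bsub>X\<^esub> x, y) - frag_of (x, lsmult M a y) \<in> tensor_relators A X M"
    using assms unfolding tensor_relators_def by blast
qed (use assms M.lact_closed frag_of_Fr in auto)

text \<open>The formal generators generate the free abelian group, whose induction principle
  proceeds by differences; the surjective quotient map carries them onto the pure tensors.\<close>

lemma pure_generate:
  "generate (add_monoid T) {pure x y | x y. x \<in> carrier X \<and> y \<in> carrier M} = carrier T"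
proof -
  let ?S = "{frag_of p | p. p \<in> carrier X \<times> carrier M}"
  have S: "?S \<subseteq> carrier Fr" using frag_of_Fr by auto
  have "c \<in> generate Fr ?S" if "c \<in> carrier Fr" for c
  proof (rule free_Abelian_group_induct[where S = "carrier X \<times> carrier M"])
    show "Poly_Mapping.keys c \<subseteq> carrier X \<times> carrier M" using that by (simp only: carrier_Fr)
    show "0 \<in> generate Fr ?S" using generate.one[of Fr ?S] by (simp add: one_Fr)
  next
    fix p q assume q: "Poly_Mapping.keys q \<subseteq> carrier X \<times> carrier M"
      and gen: "p \<in> generate Fr ?S" "q \<in> generate Fr ?S"
    have "inv\<^bsub>Fr\<^esub> q = - q" using q by (simp add: tensor_free_def)
    moreover have "inv\<^bsub>Fr\<^esub> q \<in> generate Fr ?S" using Fr.generate_m_inv_closed[OF S gen(2)] .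
    ultimately show "p - q \<in> generate Fr ?S"
      using generate.eng[OF gen(1), of "- q"] by (simp add: mult_Fr)
  qed (auto intro: generate.incl)
  then have "generate Fr ?S = carrier Fr" using Fr.generate_incl[OF S] by blast
  then have "generate (add_monoid T) (cls ` ?S) = carrier T"
    using cls.generate_img[OF S] cls_surj by simp
  moreover have "cls ` ?S = {pure x y | x y. x \<in> carrier X \<and> y \<in> carrier M}"
    by (force simp: pure_cls)
  ultimately show ?thesis by simp
qed

text \<open>The device by which maps out of a tensor product are compared below. It asks only for
  additivity, so it also proves linearity: both sides of the linearity equation are additive in
  \<open>t\<close>.\<close>

lemma tensor_hom_eqI:
  assumes "abelian_group Z" "f \<in> hom (add_monoid T) (add_monoid Z)" "g \<in> hom (add_monoid T) (add_monoid Z)"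
    and "\<And>x y. \<lbrakk>x \<in> carrier X; y \<in> carrier M\<rbrakk> \<Longrightarrow> f (pure x y) = g (pure x y)"
    and "t \<in> carrier T"
  shows "f t = g t"
  by (rule add_hom_eqI[OF T_abelian assms(1-3) pure_generate _ assms(5)]) (use assms(4) in blast)

end

section \<open>Balanced maps and the additive maps they induce\<close>

definition balanced :: "('a, 's) ring_scheme \<Rightarrow> ('a, 'm) module \<Rightarrow> ('a, 'b, 'n) bimodule \<Rightarrow>
    ('z, 't) ring_scheme \<Rightarrow> ('m \<Rightarrow> 'n \<Rightarrow> 'z) \<Rightarrow> bool" where
  "balanced A X M Z \<beta> \<longleftrightarrow>
     (\<forall>x \<in> carrier X. \<forall>y \<in> carrier M. \<beta> x y \<in> carrier Z) \<and>
     (\<forall>x \<in> carrier X. \<forall>x' \<in> carrier X. \<forall>y \<in> carrier M. \<beta> (x \<oplus>\<^bsub>X\<^esub> x') y = \<beta> x y \<oplus>\<^bsub>Z\<^esub> \<beta> x' y) \<and>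
     (\<forall>x \<in> carrier X. \<forall>y \<in> carrier M. \<forall>y' \<in> carrier M. \<beta> x (y \<oplus>\<^bsub>M\<^esub> y') = \<beta> x y \<oplus>\<^bsub>Z\<^esub> \<beta> x y') \<and>
     (\<forall>a \<in> carrier A. \<forall>x \<in> carrier X. \<forall>y \<in> carrier M. \<beta> (a \<odot>\<^bsub>X\<^esub> x) y = \<beta> x (lsmult M a y))"

locale balanced_map = tensor_pair A X M + Z: abelian_group Z
  for A :: "('a, 's) ring_scheme" and X :: "('a, 'm) module" and M :: "('a, 'b, 'n) bimodule"
    and Z :: "('z, 't) ring_scheme" +
  fixes \<beta> :: "'m \<Rightarrow> 'n \<Rightarrow> 'z"
  assumes bal: "balanced A X M Z \<beta>"
begin

definition evl :: "('m \<times> 'n \<Rightarrow>\<^sub>0 int) \<Rightarrow> 'z" where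
  "evl c = (\<Oplus>\<^bsub>Z\<^esub>p \<in> Poly_Mapping.keys c. [Poly_Mapping.lookup c p] \<cdot>\<^bsub>Z\<^esub> \<beta> (fst p) (snd p))"

lemma beta_closed: "\<lbrakk>x \<in> carrier X; y \<in> carrier M\<rbrakk> \<Longrightarrow> \<beta> x y \<in> carrier Z"
  using bal by (simp add: balanced_def)

lemma term_closed:
  fixes k :: int
  shows "p \<in> carrier X \<times> carrier M \<Longrightarrow> [k] \<cdot>\<^bsub>Z\<^esub> \<beta> (fst p) (snd p) \<in> carrier Z"
  by (auto intro!: Z.add.int_pow_closed beta_closed)

text \<open>Cancellation can make the support of \<open>c + d\<close> smaller than the union of the
  supports of \<open>c\<close> and \<open>d\<close>. Over a common finite superset the three sums
  can be compared term by term.\<close>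

lemma evl_superset:
  assumes "finite S" "Poly_Mapping.keys c \<subseteq> S" "S \<subseteq> carrier X \<times> carrier M"
  shows "evl c = (\<Oplus>\<^bsub>Z\<^esub>p \<in> S. [Poly_Mapping.lookup c p] \<cdot>\<^bsub>Z\<^esub> \<beta> (fst p) (snd p))"
  unfolding evl_def
proof (rule Z.add.finprod_mono_neutral_cong_left[OF assms(1,2)])
  fix p assume "p \<in> S - Poly_Mapping.keys c"
  then have "Poly_Mapping.lookup c p = 0" by (simp add: in_keys_iff)
  then show "[Poly_Mapping.lookup c p] \<cdot>\<^bsub>Z\<^esub> \<beta> (fst p) (snd p) = \<zero>\<^bsub>Z\<^esub>"
    by (simp add: add_pow_def)
next
  show "(\<lambda>p. [Poly_Mapping.lookup c p] \<cdot>\<^bsub>Z\<^esub> \<beta> (fst p) (snd p)) \<in> S \<rightarrow> carrier Z"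
    using assms(3) term_closed by auto
qed simp

lemma evl_hom: "evl \<in> hom Fr (add_monoid Z)"
proof -
  have cl: "evl c \<in> carrier Z" if "c \<in> carrier Fr" for c
    using that term_closed unfolding evl_def carrier_Fr by (intro Z.finsum_closed) auto
  moreover have "evl (c + d) = evl c \<oplus>\<^bsub>Z\<^esub> evl d" if cd: "c \<in> carrier Fr" "d \<in> carrier Fr" for c d
  proof -
    let ?S = "Poly_Mapping.keys c \<union> Poly_Mapping.keys d"
    have S: "finite ?S" "?S \<subseteq> carrier X \<times> carrier M" using cd by (auto simp: carrier_Fr)
    have "evl (c + d) = (\<Oplus>\<^bsub>Z\<^esub>p \<in> ?S. [Poly_Mapping.lookup (c + d) p] \<cdot>\<^bsub>Z\<^esub> \<beta> (fst p) (snd p))"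
      by (rule evl_superset[OF S(1) keys_add S(2)])
    also have "\<dots> = (\<Oplus>\<^bsub>Z\<^esub>p \<in> ?S. [Poly_Mapping.lookup c p] \<cdot>\<^bsub>Z\<^esub> \<beta> (fst p) (snd p)
        \<oplus>\<^bsub>Z\<^esub> [Poly_Mapping.lookup d p] \<cdot>\<^bsub>Z\<^esub> \<beta> (fst p) (snd p))"
    proof (rule Z.finsum_cong'[OF refl])
      show "(\<lambda>p. [Poly_Mapping.lookup c p] \<cdot>\<^bsub>Z\<^esub> \<beta> (fst p) (snd p)
        \<oplus>\<^bsub>Z\<^esub> [Poly_Mapping.lookup d p] \<cdot>\<^bsub>Z\<^esub> \<beta> (fst p) (snd p)) \<in> ?S \<rightarrow> carrier Z"
        using S(2) term_closed by (intro Pi_I Z.a_closed) blast+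
    next
      fix p assume "p \<in> ?S"
      then have "\<beta> (fst p) (snd p) \<in> carrier Z" using S(2) beta_closed by auto
      then show "[Poly_Mapping.lookup (c + d) p] \<cdot>\<^bsub>Z\<^esub> \<beta> (fst p) (snd p)
        = [Poly_Mapping.lookup c p] \<cdot>\<^bsub>Z\<^esub> \<beta> (fst p) (snd p)
        \<oplus>\<^bsub>Z\<^esub> [Poly_Mapping.lookup d p] \<cdot>\<^bsub>Z\<^esub> \<beta> (fst p) (snd p)"
        by (simp add: Poly_Mapping.lookup_add Z.add.int_pow_mult)
    qed
    also have "\<dots> = evl c \<oplus>\<^bsub>Z\<^esub> evl d"
      unfolding evl_superset[OF S(1) Un_upper1 S(2)] evl_superset[OF S(1) Un_upper2 S(2)]
      by (rule Z.finsum_addf) (use S(2) term_closed in blast)+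
    finally show ?thesis .
  qed
  ultimately show ?thesis by (auto simp: hom_def mult_Fr)
qed

sublocale evl: group_hom Fr "add_monoid Z" evl
  by (intro group_hom.intro group_hom_axioms.intro evl_hom Z.a_group Fr.group_axioms)

lemma evl_frag_of: "x \<in> carrier X \<Longrightarrow> y \<in> carrier M \<Longrightarrow> evl (frag_of (x, y)) = \<beta> x y"
  using Z.finsum_insert[of "{}" "(x, y)" "\<lambda>p. [Poly_Mapping.lookup (frag_of (x, y)) p] \<cdot>\<^bsub>Z\<^esub> \<beta> (fst p) (snd p)"]
    beta_closed[of x y]
  by (simp add: evl_def keys_frag_of Z.add.int_pow_1)

lemma evl_diff: "c \<in> carrier Fr \<Longrightarrow> d \<in> carrier Fr \<Longrightarrow> evl (c - d) = evl c \<ominus>\<^bsub>Z\<^esub> evl d"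
  using evl.hom_mult[of "c - d" d] diff_Fr[of c d] evl.hom_closed
  by (simp add: mult_Fr Z.minus_eq Z.r_neg Z.a_assoc)

lemma evl_relator:
  assumes "r \<in> tensor_relators A X M"
  shows "evl r = \<zero>\<^bsub>Z\<^esub>"
proof -
  \<comment> \<open>Both kinds of additivity relators evaluate to this form; the balancing relators
    evaluate to a difference of equal elements.\<close>
  have *: "u \<oplus>\<^bsub>Z\<^esub> v \<ominus>\<^bsub>Z\<^esub> u \<ominus>\<^bsub>Z\<^esub> v = \<zero>\<^bsub>Z\<^esub>" if "u \<in> carrier Z" "v \<in> carrier Z" for u v
    using that by (simp add: Z.minus_eq Z.a_assoc Z.r_neg1 Z.a_comm[of v] Z.l_neg Z.r_neg)
  show ?thesis
    using assms bal X.ract_closed M.lact_closed beta_closed unfolding tensor_relators_def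
    by (auto simp: evl_diff evl_frag_of frag_of_Fr diff_Fr balanced_def *) (simp add: Z.minus_eq Z.r_neg)
qed

text \<open>Evaluation kills the relators, hence the subgroup \<open>N\<close> they generate, and so
  is constant on cosets. The singleton form is what gives \<open>the_elem\<close> in
  \<open>tensor_lift\<close> its meaning.\<close>

lemma evl_cls:
  assumes "c \<in> carrier Fr"
  shows "evl ` cls c = {evl c}"
proof -
  have "tensor_relators A X M \<subseteq> kernel Fr (add_monoid Z) evl"
    using evl_relator relators_Fr by (auto simp: kernel_def)
  then have N: "N \<subseteq> kernel Fr (add_monoid Z) evl"
    unfolding tensor_null_def by (rule Fr.generate_subgroup_incl[OF _ evl.subgroup_kernel])
  have "evl d = evl c" if d: "d \<in> cls c" for d
  proof -
    obtain n where n: "n \<in> N" "d = n \<otimes>\<^bsub>Fr\<^esub> c" using d unfolding cls_def r_coset_def by blast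
    then show ?thesis using N assms evl.hom_closed[OF assms] by (auto simp: kernel_def subset_iff)
  qed
  moreover have "c \<in> cls c" unfolding cls_def using Fr.rcos_self[OF assms N_subgroup] .
  ultimately show ?thesis by blast
qed

lemma lift_cls: "c \<in> carrier Fr \<Longrightarrow> tensor_lift A X M Z \<beta> (cls c) = evl c"
  using evl_cls[of c] cls.hom_closed[of c] by (simp add: tensor_lift_def evl_def)

lemma lift_hom: "tensor_lift A X M Z \<beta> \<in> hom (add_monoid T) (add_monoid Z)"
proof (rule homI)
  fix t assume "t \<in> carrier (add_monoid T)"
  then obtain c where "c \<in> carrier Fr" "t = cls c" using cls_surj by auto
  then show "tensor_lift A X M Z \<beta> t \<in> carrier (add_monoid Z)"
    using evl.hom_closed[of c] by (simp add: lift_cls)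
next
  fix t u assume "t \<in> carrier (add_monoid T)" "u \<in> carrier (add_monoid T)"
  then obtain c d where cd: "c \<in> carrier Fr" "t = cls c" "d \<in> carrier Fr" "u = cls d"
    using cls_surj by (metis (no_types, lifting) imageE partial_object.simps(1))
  have "t \<oplus>\<^bsub>T\<^esub> u = cls (c \<otimes>\<^bsub>Fr\<^esub> d)" using cls.hom_mult[OF cd(1,3)] cd by simp
  then have "tensor_lift A X M Z \<beta> (t \<oplus>\<^bsub>T\<^esub> u) = evl c \<oplus>\<^bsub>Z\<^esub> evl d"
    using lift_cls[OF Fr.m_closed[OF cd(1,3)]] evl.hom_mult[OF cd(1,3)] by (simp only: monoid.simps)
  then show "tensor_lift A X M Z \<beta> (t \<otimes>\<^bsub>add_monoid T\<^esub> u)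
      = tensor_lift A X M Z \<beta> t \<otimes>\<^bsub>add_monoid Z\<^esub> tensor_lift A X M Z \<beta> u"
    using lift_cls[OF cd(1)] lift_cls[OF cd(3)] cd(2,4) by (simp only: monoid.simps)
qed

lemma lift_extensional: "tensor_lift A X M Z \<beta> \<in> extensional (carrier T)"
  by (simp add: tensor_lift_def)

lemma lift_pure: "\<lbrakk>x \<in> carrier X; y \<in> carrier M\<rbrakk> \<Longrightarrow> tensor_lift A X M Z \<beta> (pure x y) = \<beta> x y"
  by (simp add: pure_cls lift_cls frag_of_Fr evl_frag_of)

end

section \<open>The tensor functor of a unital bimodule\<close>

text \<open>Lets the group structure pass between records of different types with the same additive
  data: from \<open>tensor_ag\<close> to \<open>tensor\<close>, and from
  \<open>fobj F (reg A)\<close> to \<open>F_reg A F\<close>.\<close>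

lemma abelian_group_cong:
  assumes "abelian_group X" "carrier Y = carrier X" "add Y = add X" "\<zero>\<^bsub>Y\<^esub> = \<zero>\<^bsub>X\<^esub>"
  shows "abelian_group Y"
  by (rule abelian_groupI; unfold assms(2-4))
    (rule abelian_groupE[OF assms(1)]; assumption)+

text \<open>The additive monoids of \<open>X\<close> and \<open>Y\<close> may have different record
  types, so they cannot simply be equated. Agreement is carried through \<open>generate\<close>
  instead, including inverses, which depend only on carrier, operation and unit.\<close>

lemma generate_add_monoid_cong:
  assumes "carrier Y = carrier X" "add Y = add X" "\<zero>\<^bsub>Y\<^esub> = \<zero>\<^bsub>X\<^esub>"
  shows "generate (add_monoid Y) S = generate (add_monoid X) S"
proof -
  have inv: "inv\<^bsub>add_monoid Y\<^esub> x = inv\<^bsub>add_monoid X\<^esub> x" for x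
    by (simp add: m_inv_def assms)
  have "x \<in> generate (add_monoid X) S" if "x \<in> generate (add_monoid Y) S" for x
    using that
  proof (induct rule: generate.induct)
    case one
    then show ?case using generate.one[of "add_monoid X" S] by (simp add: assms)
  next
    case (inv h)
    then show ?case using generate.inv[of h S "add_monoid X"] by (simp add: \<open>inv\<^bsub>add_monoid Y\<^esub> h = _\<close>)
  next
    case (eng h1 h2)
    then show ?case using generate.eng[of h1 "add_monoid X" S h2] by (simp add: assms)
  qed (rule generate.incl)
  moreover have "x \<in> generate (add_monoid Y) S" if "x \<in> generate (add_monoid X) S" for x
    using that
  proof (induct rule: generate.induct)
    case one
    then show ?case using generate.one[of "add_monoid Y" S] by (simp add: assms)
  next
    case (inv h)
    then show ?case using generate.inv[of h S "add_monoid Y"] by (simp add: \<open>inv\<^bsub>add_monoid Y\<^esub> h = _\<close>)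
  next
    case (eng h1 h2)
    then show ?case using generate.eng[of h1 "add_monoid Y" S h2] by (simp add: assms)
  qed (rule generate.incl)
  ultimately show ?thesis by blast
qed

lemma carrier_tensor [simp]: "carrier (tensor A X M) = carrier (tensor_ag A X M)"
  and add_tensor [simp]: "add (tensor A X M) = add (tensor_ag A X M)"
  and zero_tensor [simp]: "\<zero>\<^bsub>tensor A X M\<^esub> = \<zero>\<^bsub>tensor_ag A X M\<^esub>"
  and smult_tensor: "b \<odot>\<^bsub>tensor A X M\<^esub> t =
    tensor_lift A X M (tensor_ag A X M) (\<lambda>x y. pure_tensor A X M x (b \<odot>\<^bsub>M\<^esub> y)) t"
  by (simp_all add: tensor_def ring.defs module.defs)

lemma hom_from_tensor:
  "hom (add_monoid (tensor A X M)) G = hom (add_monoid (tensor_ag A X M)) G"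
  by (simp add: hom_def)

lemma hom_to_tensor:
  "hom G (add_monoid (tensor A X M)) = hom G (add_monoid (tensor_ag A X M))"
  by (simp add: hom_def)

lemma (in tensor_pair) tensor_abelian: "abelian_group (tensor A X M)"
  by (rule abelian_group_cong[OF T_abelian]) simp_all

lemma (in tensor_pair) tensor_mhom_eqI:
  assumes "abelian_group Z" "f \<in> mhom B (tensor A X M) Z" "g \<in> mhom B (tensor A X M) Z"
    and "\<And>x y. \<lbrakk>x \<in> carrier X; y \<in> carrier M\<rbrakk> \<Longrightarrow> f (pure x y) = g (pure x y)"
  shows "f = g"
  using assms tensor_hom_eqI[OF assms(1) mhom_hom[OF assms(2), unfolded hom_from_tensor]
      mhom_hom[OF assms(3), unfolded hom_from_tensor]]
  by (auto intro!: mhom_eqI[OF assms(2,3)])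

locale bimodule_pair = A: ring_with_local_units K A + B: ring_with_local_units K B + M: unital_bimodule A B M
  for K :: "('k, 'r) ring_scheme" and A :: "('k, 'a, 's) module_scheme"
    and B :: "('k, 'b, 't) module_scheme" and M :: "('a, 'b, 'n) bimodule"
begin

lemma tensor_pairI: "X \<in> UMod A \<Longrightarrow> tensor_pair A X M"
  by (intro tensor_pair.intro UMod_right_module M.left.unital_left_module_axioms)

text \<open>Balancing rests on the commuting actions: \<open>x a \<otimes> y b = x \<otimes> a (y b)
  = x \<otimes> (a y) b\<close>.\<close>

lemma ract_balanced:
  assumes "X \<in> UMod A" "b \<in> carrier B"
  shows "balanced_map A X M (tensor_ag A X M) (\<lambda>x y. pure_tensor A X M x (b \<odot>\<^bsub>M\<^esub> y))"
proof -
  interpret tensor_pair A X M by (rule tensor_pairI[OF assms(1)])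
  show ?thesis
    by unfold_locales
      (use assms(2) in \<open>simp add: balanced_def pure_closed pure_add_left pure_add_right pure_balanced
        M.right.ract_closed M.right.ract_add X.ract_closed M.actions_commute\<close>)
qed

lemma tensor_ract_pure:
  assumes "X \<in> UMod A" "b \<in> carrier B" "x \<in> carrier X" "y \<in> carrier M"
  shows "b \<odot>\<^bsub>tensor A X M\<^esub> pure_tensor A X M x y = pure_tensor A X M x (b \<odot>\<^bsub>M\<^esub> y)"
  using balanced_map.lift_pure[OF ract_balanced] assms by (simp add: smult_tensor)

lemma tensor_ract_hom:
  assumes "X \<in> UMod A" "b \<in> carrier B"
  shows "(\<lambda>t. b \<odot>\<^bsub>tensor A X M\<^esub> t) \<in> hom (add_monoid (tensor_ag A X M)) (add_monoid (tensor_ag A X M))"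
  using balanced_map.lift_hom[OF ract_balanced] assms by (simp add: smult_tensor)

text \<open>The module laws compare maps additive in \<open>t\<close>, so pure tensors suffice. For
  unitality, \<open>y e = y\<close> gives \<open>(x \<otimes> y) e = x \<otimes> y\<close>; hence
  the pure tensors, which generate, lie among the products.\<close>

lemma tensor_UMod:
  assumes X: "X \<in> UMod A"
  shows "tensor A X M \<in> UMod B"
proof -
  interpret tensor_pair A X M by (rule tensor_pairI[OF X])
  let ?T = "tensor A X M"
  note h = tensor_ract_hom[OF X]
  have cl: "b \<odot>\<^bsub>?T\<^esub> t \<in> carrier T" if "b \<in> carrier B" "t \<in> carrier T" for b t
    using hom_in_carrier[OF h, of b t] that by simp
  have add: "b \<odot>\<^bsub>?T\<^esub> (t \<oplus>\<^bsub>T\<^esub> u) = b \<odot>\<^bsub>?T\<^esub> t \<oplus>\<^bsub>T\<^esub> b \<odot>\<^bsub>?T\<^esub> u"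
    if "b \<in> carrier B" "t \<in> carrier T" "u \<in> carrier T" for b t u
    using hom_mult[OF h, of b t u] that by simp
  have add_ring: "(b \<oplus>\<^bsub>B\<^esub> c) \<odot>\<^bsub>?T\<^esub> t = b \<odot>\<^bsub>?T\<^esub> t \<oplus>\<^bsub>T\<^esub> c \<odot>\<^bsub>?T\<^esub> t"
    if "b \<in> carrier B" "c \<in> carrier B" "t \<in> carrier T" for b c t
  proof (rule tensor_hom_eqI[OF T_abelian h _ _ that(3)])
    show "(\<lambda>t. b \<odot>\<^bsub>?T\<^esub> t \<oplus>\<^bsub>T\<^esub> c \<odot>\<^bsub>?T\<^esub> t) \<in> hom (add_monoid T) (add_monoid T)"
      using that cl add by (auto simp: hom_def T.add.m_ac)
  qed (use that in \<open>simp_all add: tensor_ract_pure X M.right.ract_add_ring pure_add_right M.right.ract_closed\<close>)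
  have assoc: "(b \<otimes>\<^bsub>B\<^esub> c) \<odot>\<^bsub>?T\<^esub> t = c \<odot>\<^bsub>?T\<^esub> (b \<odot>\<^bsub>?T\<^esub> t)"
    if "b \<in> carrier B" "c \<in> carrier B" "t \<in> carrier T" for b c t
  proof (rule tensor_hom_eqI[OF T_abelian h _ _ that(3)])
    show "(\<lambda>t. c \<odot>\<^bsub>?T\<^esub> (b \<odot>\<^bsub>?T\<^esub> t)) \<in> hom (add_monoid T) (add_monoid T)"
      using that cl add by (auto simp: hom_def)
  qed (use that in \<open>simp_all add: tensor_ract_pure X M.right.ract_assoc M.right.ract_closed B.mult_closed\<close>)
  interpret R: right_module B ?T
    using tensor_abelian cl add add_ring assoc
    by (simp add: right_module_def right_module_axioms_def)
  let ?P = "{pure x y | x y. x \<in> carrier X \<and> y \<in> carrier M}"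
  let ?S = "{b \<odot>\<^bsub>?T\<^esub> t | b t. b \<in> carrier B \<and> t \<in> carrier ?T}"
  have "?P \<subseteq> ?S"
  proof clarify
    fix x y assume xy: "x \<in> carrier X" "y \<in> carrier M"
    obtain e where e: "e \<in> Idemp B" "e \<odot>\<^bsub>M\<^esub> y = y"
      using B.local_unit_module[OF M.right.unital_right_module_axioms xy(2)] by blast
    show "\<exists>b t. pure x y = b \<odot>\<^bsub>?T\<^esub> t \<and> b \<in> carrier B \<and> t \<in> carrier ?T"
      by (intro exI[of _ e] exI[of _ "pure x y"])
        (use e xy in \<open>simp add: B.Idemp_closed pure_closed tensor_ract_pure[OF X]\<close>)
  qed
  then have "carrier ?T \<subseteq> generate (add_monoid ?T) ?S"
    using T.add.mono_generate[of ?P ?S] pure_generate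
      generate_add_monoid_cong[of ?T T ?S] by simp
  moreover have "generate (add_monoid ?T) ?S \<subseteq> carrier ?T"
    using R.ract_closed by (intro R.add.generate_incl) auto
  ultimately have "generate (add_monoid ?T) ?S = carrier ?T" by blast
  then have "unital_right_module B ?T" by unfold_locales
  then show ?thesis by (simp add: UMod_def)
qed

section \<open>Functoriality of the tensor product\<close>

lemma tensor_map_balanced:
  assumes "X \<in> UMod A" "Y \<in> UMod A" "f \<in> mhom A X Y"
  shows "balanced_map A X M (tensor_ag A Y M) (\<lambda>x y. pure_tensor A Y M (f x) y)"
proof -
  interpret X: tensor_pair A X M by (rule tensor_pairI[OF assms(1)])
  interpret Y: tensor_pair A Y M by (rule tensor_pairI[OF assms(2)])
  show ?thesis
    by unfold_locales
      (simp add: balanced_def mhom_closed[OF assms(3)] mhom_add[OF assms(3)] mhom_ract[OF assms(3)]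
        Y.pure_closed Y.pure_add_left Y.pure_add_right Y.pure_balanced)
qed

abbreviation "G \<equiv> tensor_functor A M"

lemma G_obj: "fobj G X = tensor A X M"
  by (simp add: tensor_functor_def)

lemma G_arr_pure:
  assumes "X \<in> UMod A" "Y \<in> UMod A" "f \<in> mhom A X Y" "x \<in> carrier X" "y \<in> carrier M"
  shows "farr G X Y f (pure_tensor A X M x y) = pure_tensor A Y M (f x) y"
  using balanced_map.lift_pure[OF tensor_map_balanced] assms by (simp add: tensor_functor_def)

lemma G_arr_hom:
  assumes "X \<in> UMod A" "Y \<in> UMod A" "f \<in> mhom A X Y"
  shows "farr G X Y f \<in> hom (add_monoid (tensor_ag A X M)) (add_monoid (tensor_ag A Y M))"
  using balanced_map.lift_hom[OF tensor_map_balanced] assms by (simp add: tensor_functor_def)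

lemma G_arr_mhom:
  assumes "X \<in> UMod A" "Y \<in> UMod A" "f \<in> mhom A X Y"
  shows "farr G X Y f \<in> mhom B (tensor A X M) (tensor A Y M)"
proof (rule mhomI)
  interpret X: tensor_pair A X M by (rule tensor_pairI[OF assms(1)])
  interpret Y: tensor_pair A Y M by (rule tensor_pairI[OF assms(2)])
  show "farr G X Y f \<in> extensional (carrier (tensor A X M))"
    using balanced_map.lift_extensional[OF tensor_map_balanced[OF assms]] by (simp add: tensor_functor_def)
  show "farr G X Y f \<in> hom (add_monoid (tensor A X M)) (add_monoid (tensor A Y M))"
    using G_arr_hom[OF assms] by (simp only: hom_from_tensor hom_to_tensor)
  fix b t assume b: "b \<in> carrier B" and t: "t \<in> carrier (tensor A X M)"
  note h = G_arr_hom[OF assms]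
  show "farr G X Y f (b \<odot>\<^bsub>tensor A X M\<^esub> t) = b \<odot>\<^bsub>tensor A Y M\<^esub> farr G X Y f t"
  proof (rule X.tensor_hom_eqI[OF Y.T_abelian, where f = "\<lambda>t. farr G X Y f (b \<odot>\<^bsub>tensor A X M\<^esub> t)"
        and g = "\<lambda>t. b \<odot>\<^bsub>tensor A Y M\<^esub> farr G X Y f t"])
    show "(\<lambda>t. farr G X Y f (b \<odot>\<^bsub>tensor A X M\<^esub> t)) \<in> hom (add_monoid X.T) (add_monoid Y.T)"
      using Group.hom_compose[OF tensor_ract_hom[OF assms(1) b] h] by (simp add: comp_def)
    show "(\<lambda>t. b \<odot>\<^bsub>tensor A Y M\<^esub> farr G X Y f t) \<in> hom (add_monoid X.T) (add_monoid Y.T)"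
      using Group.hom_compose[OF h tensor_ract_hom[OF assms(2) b]] by (simp add: comp_def)
  qed (use b t mhom_closed[OF assms(3)] in \<open>simp_all add: tensor_ract_pure assms G_arr_pure M.right.ract_closed\<close>)
qed

lemma tensor_covariant_functor: "covariant_functor A B G"
proof (unfold_locales, goal_cases)
  case (1 X)
  then show ?case by (simp add: G_obj tensor_UMod)
next
  case (2 X Y f)
  then show ?case by (simp only: G_obj G_arr_mhom)
next
  case (3 X)
  interpret X: tensor_pair A X M by (rule tensor_pairI[OF 3])
  interpret R: right_module B "tensor A X M" by (rule UMod_right_module[OF tensor_UMod[OF 3]])
  show ?case
    unfolding G_obj
    by (rule X.tensor_mhom_eqI[OF X.tensor_abelian G_arr_mhom R.mhom_id])
      (use 3 X.X.mhom_id in \<open>simp_all add: G_arr_pure X.pure_closed\<close>)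
next
  case (4 X Y Z f g)
  interpret X: tensor_pair A X M by (rule tensor_pairI[OF 4(1)])
  interpret R: right_module B "tensor A X M" by (rule UMod_right_module[OF tensor_UMod[OF 4(1)]])
  interpret Z: tensor_pair A Z M by (rule tensor_pairI[OF 4(3)])
  have c: "compose (carrier X) g f \<in> mhom A X Z" by (rule X.X.mhom_compose[OF 4(4,5)])
  show ?case
    unfolding G_obj
    by (rule X.tensor_mhom_eqI[OF Z.tensor_abelian G_arr_mhom[OF 4(1,3) c]
          R.mhom_compose[OF G_arr_mhom[OF 4(1,2,4)] G_arr_mhom[OF 4(2,3,5)]]])
      (use c 4 mhom_closed[OF 4(4)] in \<open>simp_all add: G_arr_pure compose_eq X.pure_closed\<close>)
qed

end

section \<open>Direct sums\<close>

definition sum_single :: "'i set \<Rightarrow> ('i \<Rightarrow> ('m, 't) monoid_scheme) \<Rightarrow> 'i \<Rightarrow> 'm \<Rightarrow> 'i \<Rightarrow> 'm" where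
  "sum_single I G i x = (\<lambda>k \<in> I. if k = i then x else \<one>\<^bsub>G k\<^esub>)"

locale group_family =
  fixes I :: "'i set" and G :: "'i \<Rightarrow> ('m, 't) monoid_scheme"
  assumes grp: "\<And>i. i \<in> I \<Longrightarrow> group (G i)"
begin

lemma sum_single_closed:
  assumes "i \<in> I" "x \<in> carrier (G i)"
  shows "sum_single I G i x \<in> carrier (sum_group I G)"
proof -
  have "finite {k \<in> I. sum_single I G i x k \<noteq> \<one>\<^bsub>G k\<^esub>}"
    by (rule finite_subset[of _ "{i}"]) (auto simp: sum_single_def)
  then show ?thesis
    using assms grp by (auto simp: carrier_sum_group PiE_iff sum_single_def group.is_monoid monoid.one_closed)
qed

text \<open>Induction on a finite set \<open>J\<close> containing the support: a step splits off the
  coordinate \<open>j\<close> and leaves \<open>d\<close>, which is \<open>c\<close> with that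
  coordinate reset to the unit. Since \<open>J\<close> only bounds the support, indices
  \<open>j\<close> outside \<open>I\<close> do no harm.\<close>

lemma sum_single_generate:
  "generate (sum_group I G) {sum_single I G i x | i x. i \<in> I \<and> x \<in> carrier (G i)} = carrier (sum_group I G)"
    (is "generate ?S ?D = _")
proof -
  interpret S: group ?S using grp by (rule sum_group)
  have D: "?D \<subseteq> carrier ?S" using sum_single_closed by auto
  have "c \<in> generate ?S ?D" if "finite J" "c \<in> carrier ?S" "{k \<in> I. c k \<noteq> \<one>\<^bsub>G k\<^esub>} \<subseteq> J" for J c
    using that
  proof (induct J arbitrary: c rule: finite_induct)
    case empty
    then have "c \<in> extensional I" using grp by (simp add: carrier_sum_group PiE_iff)
    moreover have "c k = \<one>\<^bsub>G k\<^esub>" if "k \<in> I" for k using empty(2) that by blast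
    ultimately have "c = \<one>\<^bsub>?S\<^esub>" by (auto simp: extensional_def)
    then show ?case using generate.one[of ?S ?D] by (simp only:)
  next
    case (insert j J)
    show ?case
    proof (cases "j \<in> I")
      case False
      then show ?thesis using insert.prems insert.hyps(3) by blast
    next
      case True
      have cext: "c \<in> extensional I" and cl: "\<And>k. k \<in> I \<Longrightarrow> c k \<in> carrier (G k)"
        using insert.prems(1) grp by (simp_all add: carrier_sum_group PiE_iff)
      define d where "d = (\<lambda>k\<in>I. if k = j then \<one>\<^bsub>G k\<^esub> else c k)"
      have dfin: "{k \<in> I. d k \<noteq> \<one>\<^bsub>G k\<^esub>} \<subseteq> J" using insert.prems(2) by (auto simp: d_def)
      then have dc: "d \<in> carrier ?S"
        using finite_subset[OF dfin insert.hyps(1)] grp cl group.is_monoid[OF grp, THEN monoid.one_closed]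
        by (simp add: carrier_sum_group PiE_iff d_def)
      have "c k = (sum_single I G j (c j) \<otimes>\<^bsub>?S\<^esub> d) k" for k
        using group.is_monoid[OF grp, of k, THEN monoid.l_one, of "c k"]
          group.is_monoid[OF grp, of k, THEN monoid.r_one, of "c k"] cl[of k] extensional_arb[OF cext, of k]
        by (cases "k \<in> I"; cases "k = j") (simp_all add: sum_single_def d_def)
      then have eq: "c = sum_single I G j (c j) \<otimes>\<^bsub>?S\<^esub> d" by (rule ext)
      have "sum_single I G j (c j) \<in> ?D" using True cl[OF True] by blast
      then show ?thesis
        by (subst eq) (rule generate.eng[OF generate.incl insert.hyps(3)[OF dc dfin]])
    qed
  qed
  moreover have "finite {k \<in> I. c k \<noteq> \<one>\<^bsub>G k\<^esub>}" if "c \<in> carrier ?S" for c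
    using that grp by (simp add: carrier_sum_group)
  ultimately have "carrier ?S \<subseteq> generate ?S ?D" by blast
  then show ?thesis using S.generate_incl[OF D] by blast
qed

text \<open>Homomorphisms preserve the unit, so only the factor at \<open>i\<close> can be
  nontrivial, and the product over the possibly infinite \<open>I\<close> collapses to it.\<close>

lemma gfinprod_sum_single:
  assumes "comm_group H" "\<And>k. k \<in> I \<Longrightarrow> f k \<in> hom (G k) H" "i \<in> I" "x \<in> carrier (G i)"
  shows "gfinprod H (\<lambda>k. f k (sum_single I G i x k)) I = f i x"
proof -
  interpret H: comm_group H by fact
  have one: "f k \<one>\<^bsub>G k\<^esub> = \<one>\<^bsub>H\<^esub>" if "k \<in> I" for k
    using hom_one[OF assms(2)[OF that] grp[OF that] H.group_axioms] .
  have fx: "f i x \<in> carrier H" using hom_in_carrier[OF assms(2)[OF assms(3)] assms(4)] .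
  have val: "f k (sum_single I G i x k) = (if k = i then f i x else \<one>\<^bsub>H\<^esub>)" if "k \<in> I" for k
    using that one[OF that] by (simp add: sum_single_def)
  have "gfinprod H (\<lambda>k. f k (sum_single I G i x k)) I = gfinprod H (\<lambda>k. f i x) {i}"
  proof (rule H.gfinprod_mono_neutral_cong_right)
    show "(\<lambda>k. f k (sum_single I G i x k)) \<in> I \<rightarrow> carrier H"
      using val fx by simp
  qed (use assms(3) val in simp_all)
  also have "\<dots> = finprod H (\<lambda>k. f i x) {i}" using fx by (intro H.gfinprod_eq_finprod) auto
  also have "\<dots> = f i x" using H.finprod_insert[of "{}" i "\<lambda>k. f i x"] fx by simp
  finally show ?thesis .
qed

end

section \<open>Direct sums: generation and universal property\<close>

lemma is_direct_sumD:
  assumes "is_direct_sum A I X \<iota> S"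
  shows "S \<in> UMod A" "\<And>i. i \<in> I \<Longrightarrow> X i \<in> UMod A" "\<And>i. i \<in> I \<Longrightarrow> \<iota> i \<in> mhom A (X i) S"
    "(\<lambda>x. gfinprod (add_monoid S) (\<lambda>i. \<iota> i (x i)) I)
       \<in> iso (sum_group I (\<lambda>i. add_monoid (X i))) (add_monoid S)"
  using assms by (auto simp: is_direct_sum_def)

lemma direct_sum_family: "is_direct_sum A I X \<iota> S \<Longrightarrow> group_family I (\<lambda>i. add_monoid (X i))"
  by (intro group_family.intro abelian_group.a_group UMod_abelian is_direct_sumD(2))

lemma direct_sum_single:
  assumes "is_direct_sum A I X \<iota> S" "i \<in> I" "x \<in> carrier (X i)"
  shows "gfinprod (add_monoid S) (\<lambda>k. \<iota> k (sum_single I (\<lambda>i. add_monoid (X i)) i x k)) I = \<iota> i x"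
proof (rule group_family.gfinprod_sum_single[OF direct_sum_family[OF assms(1)]])
  show "comm_group (add_monoid S)"
    using is_direct_sumD(1)[OF assms(1)] UMod_abelian abelian_group.a_comm_group by blast
qed (use assms mhom_hom[OF is_direct_sumD(3)[OF assms(1)]] in auto)

lemma direct_sum_generate:
  assumes ds: "is_direct_sum A I X \<iota> S"
  shows "generate (add_monoid S) {\<iota> i x | i x. i \<in> I \<and> x \<in> carrier (X i)} = carrier S"
proof -
  let ?G = "\<lambda>i. add_monoid (X i)"
  let ?h = "\<lambda>x. gfinprod (add_monoid S) (\<lambda>i. \<iota> i (x i)) I"
  interpret fam: group_family I ?G by (rule direct_sum_family[OF ds])
  interpret S: abelian_group S using is_direct_sumD(1)[OF ds] by (rule UMod_abelian)
  have grp: "group (sum_group I ?G)" by (rule sum_group[OF fam.grp])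
  have iso: "?h \<in> iso (sum_group I ?G) (add_monoid S)" by (rule is_direct_sumD(4)[OF ds])
  interpret h: group_hom "sum_group I ?G" "add_monoid S" ?h
    by (intro group_hom.intro group_hom_axioms.intro grp S.a_group) (use iso in \<open>simp add: iso_def\<close>)
  let ?D = "{sum_single I ?G i x | i x. i \<in> I \<and> x \<in> carrier (?G i)}"
  have D: "?D \<subseteq> carrier (sum_group I ?G)" by (clarify; rule fam.sum_single_closed)
  have "generate (add_monoid S) (?h ` ?D) = ?h ` carrier (sum_group I ?G)"
    using h.generate_img[OF D] unfolding fam.sum_single_generate .
  also have "\<dots> = carrier S" using iso by (simp add: iso_def bij_betw_def)
  also have "?h ` ?D = {\<iota> i x | i x. i \<in> I \<and> x \<in> carrier (X i)}"
  proof (intro equalityI subsetI)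
    fix z assume "z \<in> ?h ` ?D"
    then obtain i x where ix: "z = ?h (sum_single I ?G i x)" "i \<in> I" "x \<in> carrier (X i)" by auto
    then have "z = \<iota> i x" using direct_sum_single[OF ds] by simp
    then show "z \<in> {\<iota> i x | i x. i \<in> I \<and> x \<in> carrier (X i)}" using ix by blast
  next
    fix z assume "z \<in> {\<iota> i x | i x. i \<in> I \<and> x \<in> carrier (X i)}"
    then obtain i x where ix: "z = \<iota> i x" "i \<in> I" "x \<in> carrier (X i)" by blast
    then have "z = ?h (sum_single I ?G i x)" using direct_sum_single[OF ds] by simp
    moreover have "sum_single I ?G i x \<in> ?D" using ix by auto
    ultimately show "z \<in> ?h ` ?D" by (rule image_eqI)
  qed
  finally show ?thesis .
qed

text \<open>The map is the inverse of the canonical isomorphism followed by the sum of the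
  \<open>g i\<close>. It is kept at the level of additive maps because one application has a mere
  tensor group as target; where linearity is wanted, it is verified afterwards on
  generators.\<close>

lemma direct_sum_universal:
  assumes ds: "is_direct_sum A I X \<iota> S" and Z: "abelian_group Z"
    and g: "\<And>i. i \<in> I \<Longrightarrow> g i \<in> hom (add_monoid (X i)) (add_monoid Z)"
  shows "\<exists>h \<in> hom (add_monoid S) (add_monoid Z). \<forall>i \<in> I. \<forall>x \<in> carrier (X i). h (\<iota> i x) = g i x"
proof -
  let ?G = "\<lambda>i. add_monoid (X i)"
  let ?h = "\<lambda>x. gfinprod (add_monoid S) (\<lambda>i. \<iota> i (x i)) I"
  let ?k = "\<lambda>x. gfinprod (add_monoid Z) (\<lambda>i. g i (x i)) I"
  let ?inv = "inv_into (carrier (sum_group I ?G)) ?h"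
  interpret fam: group_family I ?G by (rule direct_sum_family[OF ds])
  interpret Z: abelian_group Z by (rule Z)
  have iso: "?h \<in> iso (sum_group I ?G) (add_monoid S)" by (rule is_direct_sumD(4)[OF ds])
  have inv: "?inv \<in> hom (add_monoid S) (sum_group I ?G)"
    using group.iso_set_sym[OF sum_group[OF fam.grp] iso] by (simp add: iso_def)
  have k: "?k \<in> hom (sum_group I ?G) (add_monoid Z)"
    by (rule comm_group.hom_group_sum[OF Z.a_comm_group g fam.grp])
  show ?thesis
  proof (intro bexI ballI)
    show "?k \<circ> ?inv \<in> hom (add_monoid S) (add_monoid Z)" by (rule Group.hom_compose[OF inv k])
    fix i x assume ix: "i \<in> I" "x \<in> carrier (X i)"
    have "?inv (\<iota> i x) = sum_single I ?G i x"
      using iso fam.sum_single_closed[of i x] ix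
      by (intro inv_into_f_eq) (simp_all add: iso_def bij_betw_def direct_sum_single[OF ds])
    then show "(?k \<circ> ?inv) (\<iota> i x) = g i x"
      using fam.gfinprod_sum_single[OF Z.a_comm_group g, of i x] ix by simp
  qed
qed

text \<open>The external direct sum has carrier type \<open>'i \<Rightarrow> 'm\<close>. To obtain a direct sum inside the type \<open>'u\<close> of
  the given modules, it is transported along an injection of the finitely supported families into
  \<open>'u\<close>; this is where \<open>'u\<close> has to be infinite.\<close>

definition ext_sum :: "'i set \<Rightarrow> ('i \<Rightarrow> ('a, 'm) module) \<Rightarrow> ('a, 'i \<Rightarrow> 'm) module" where
  "ext_sum I X = (let G = sum_group I (\<lambda>i. add_monoid (X i)) in
     \<lparr>carrier = carrier G, monoid.mult = undefined, one = undefined, ring.zero = \<one>\<^bsub>G\<^esub>,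
      add = monoid.mult G, smult = (\<lambda>a c. \<lambda>i \<in> I. a \<odot>\<^bsub>X i\<^esub> c i)\<rparr>)"

definition transport_mod :: "('m \<Rightarrow> 'n) \<Rightarrow> ('a, 'm) module \<Rightarrow> ('a, 'n) module" where
  "transport_mod j X = (let r = inv_into (carrier X) j in
     \<lparr>carrier = j ` carrier X, monoid.mult = undefined, one = undefined, ring.zero = j \<zero>\<^bsub>X\<^esub>,
      add = (\<lambda>s t. j (r s \<oplus>\<^bsub>X\<^esub> r t)), smult = (\<lambda>a s. j (a \<odot>\<^bsub>X\<^esub> r s))\<rparr>)"

lemma transport_mod_simps:
  "carrier (transport_mod j X) = j ` carrier X" "\<zero>\<^bsub>transport_mod j X\<^esub> = j \<zero>\<^bsub>X\<^esub>"
  by (simp_all add: transport_mod_def Let_def)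

lemma transport_mod_ops:
  assumes "inj_on j (carrier X)"
  shows "x \<in> carrier X \<Longrightarrow> y \<in> carrier X \<Longrightarrow> j x \<oplus>\<^bsub>transport_mod j X\<^esub> j y = j (x \<oplus>\<^bsub>X\<^esub> y)"
    and "x \<in> carrier X \<Longrightarrow> a \<odot>\<^bsub>transport_mod j X\<^esub> j x = j (a \<odot>\<^bsub>X\<^esub> x)"
  using assms by (simp_all add: transport_mod_def Let_def)

lemma transport_right_module:
  assumes "right_module A X" "inj_on j (carrier X)"
  shows "right_module A (transport_mod j X)"
proof -
  interpret right_module A X by fact
  note ops = transport_mod_simps transport_mod_ops[OF assms(2)]
  have "abelian_group (transport_mod j X)"
  proof (rule abelian_groupI)
    fix t assume "t \<in> carrier (transport_mod j X)"
    then obtain x where "t = j x" "x \<in> carrier X" by (auto simp: ops)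
    then show "\<exists>s \<in> carrier (transport_mod j X). s \<oplus>\<^bsub>transport_mod j X\<^esub> t = \<zero>\<^bsub>transport_mod j X\<^esub>"
      by (intro bexI[of _ "j (\<ominus>\<^bsub>X\<^esub> x)"]) (simp_all add: ops l_neg)
  next
    fix s t assume "s \<in> carrier (transport_mod j X)" "t \<in> carrier (transport_mod j X)"
    then show "s \<oplus>\<^bsub>transport_mod j X\<^esub> t = t \<oplus>\<^bsub>transport_mod j X\<^esub> s"
      by (auto simp: ops) (simp add: a_comm)
  qed (auto simp: ops a_assoc)
  then show ?thesis
    by (auto simp: right_module_def right_module_axioms_def ops ract_closed ract_add_ring ract_add ract_assoc)
qed

text \<open>A family differing from \<open>d\<close> at finitely many indices is determined by the
  finite graph of its deviating part, extensionality fixing the values outside \<open>I\<close>. For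
  infinite \<open>'u\<close> the finite subsets of \<open>'u \<times> 'u\<close> are equinumerous
  with \<open>'u \<times> 'u\<close>, hence with \<open>'u\<close>.\<close>

lemma inj_finite_families:
  assumes "infinite (UNIV :: 'u set)"
  obtains j :: "('u \<Rightarrow> 'u) \<Rightarrow> 'u" where
    "inj_on j {c \<in> extensional I. finite {i \<in> I. c i \<noteq> d i}}" 
proof -
  let ?C = "{c \<in> extensional I. finite {i \<in> I. c i \<noteq> d i}} :: ('u \<Rightarrow> 'u) set"
  let ?gr = "\<lambda>c. (\<lambda>i. (i, c i)) ` {i \<in> I. c i \<noteq> d i} :: ('u \<times> 'u) set"
  have inf: "infinite (UNIV :: ('u \<times> 'u) set)" using assms finite_prod by blast
  have "inj_on ?gr ?C"
  proof (rule inj_onI)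
    fix c c' assume c: "c \<in> ?C" "c' \<in> ?C" "?gr c = ?gr c'"
    have mem: "(i, v) \<in> ?gr b \<longleftrightarrow> i \<in> I \<and> b i \<noteq> d i \<and> v = b i" for i v b by auto
    have "c i = c' i" if "i \<in> I" for i
      using mem[of i "c i" c] mem[of i "c' i" c'] mem[of i "c i" c'] mem[of i "c' i" c] c(3) that by metis
    then show "c = c'" using c(1,2) by (auto intro: extensionalityI)
  qed
  moreover have "?gr ` ?C \<subseteq> Fpow UNIV" by (auto simp: Fpow_def)
  ultimately have "?C \<lesssim> Fpow (UNIV :: ('u \<times> 'u) set)" unfolding lepoll_def by blast
  also have "\<dots> \<approx> (UNIV :: ('u \<times> 'u) set)" by (rule eqpoll_Fpow[OF inf])
  also have "\<dots> \<approx> (UNIV :: 'u set)"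
    unfolding eqpoll_iff_card_of_ordIso using card_of_Times_same_infinite[OF assms] by simp
  finally show thesis using that unfolding lepoll_def by blast
qed

text \<open>Unitality uses finite support: each coordinate has its own idempotent
  \<open>e i\<close>, and a common local unit \<open>g\<close> of the finitely many
  \<open>e i\<close> on the support fixes the whole family.\<close>

lemma (in ring_with_local_units) ext_sum_UMod:
  assumes "\<And>i. i \<in> I \<Longrightarrow> X i \<in> UMod A"
  shows "ext_sum I X \<in> UMod A"
proof -
  let ?G = "\<lambda>i. add_monoid (X i)"
  let ?S = "sum_group I ?G"
  have ab: "abelian_group (X i)" and rm: "right_module A (X i)" if "i \<in> I" for i
    using assms[OF that] by (simp_all add: UMod_abelian UMod_right_module)
  have grp: "group (?G i)" if "i \<in> I" for i using ab[OF that] by (rule abelian_group.a_group)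
  have S: "c \<in> carrier ?S \<longleftrightarrow> c \<in> extensional I \<and> (\<forall>i\<in>I. c i \<in> carrier (X i)) \<and> finite {i \<in> I. c i \<noteq> \<zero>\<^bsub>X i\<^esub>}" for c
    using carrier_sum_group[OF grp, of I] by (auto simp: PiE_iff)
  interpret S: group ?S by (rule sum_group[OF grp])
  have simps: "carrier (ext_sum I X) = carrier ?S" "\<zero>\<^bsub>ext_sum I X\<^esub> = \<one>\<^bsub>?S\<^esub>" "add (ext_sum I X) = monoid.mult ?S"
    "\<And>a c. a \<odot>\<^bsub>ext_sum I X\<^esub> c = (\<lambda>i \<in> I. a \<odot>\<^bsub>X i\<^esub> c i)"
    by (simp_all add: ext_sum_def Let_def)
  have "abelian_group (ext_sum I X)"
  proof (rule abelian_groupI; unfold simps)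
    fix c d assume cd: "c \<in> carrier ?S" "d \<in> carrier ?S"
    show "c \<otimes>\<^bsub>?S\<^esub> d = d \<otimes>\<^bsub>?S\<^esub> c"
      using cd abelian_groupE(4)[OF ab] by (simp add: S restrict_def fun_eq_iff)
  qed (rule S.m_closed S.one_closed S.m_assoc S.l_one S.l_inv_ex; assumption)+
  moreover have "(\<lambda>i\<in>I. a \<odot>\<^bsub>X i\<^esub> c i) \<in> carrier ?S" if "a \<in> carrier A" "c \<in> carrier ?S" for a c
  proof -
    have "{i \<in> I. (\<lambda>i\<in>I. a \<odot>\<^bsub>X i\<^esub> c i) i \<noteq> \<zero>\<^bsub>X i\<^esub>} \<subseteq> {i \<in> I. c i \<noteq> \<zero>\<^bsub>X i\<^esub>}"
      using right_module.ract_zero[OF rm that(1)] by auto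
    moreover have "finite {i \<in> I. c i \<noteq> \<zero>\<^bsub>X i\<^esub>}" using that S by blast
    ultimately have "finite {i \<in> I. (\<lambda>i\<in>I. a \<odot>\<^bsub>X i\<^esub> c i) i \<noteq> \<zero>\<^bsub>X i\<^esub>}" by (rule finite_subset)
    then show ?thesis using that right_module.ract_closed[OF rm that(1)] by (simp add: S)
  qed
  ultimately have "right_module A (ext_sum I X)"
    unfolding right_module_def right_module_axioms_def simps
    using right_module.ract_add_ring[OF rm] right_module.ract_add[OF rm] right_module.ract_assoc[OF rm]
    by (simp add: S restrict_def fun_eq_iff)
  then show ?thesis
    unfolding UMod_def
  proof (intro CollectI unitalI)
    fix c assume "c \<in> carrier (ext_sum I X)"
    then have c: "c \<in> extensional I" "\<And>i. i \<in> I \<Longrightarrow> c i \<in> carrier (X i)" "finite {i \<in> I. c i \<noteq> \<zero>\<^bsub>X i\<^esub>}"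
      by (simp_all add: simps S)
    let ?J = "{i \<in> I. c i \<noteq> \<zero>\<^bsub>X i\<^esub>}"
    have "\<exists>e. \<forall>i \<in> I. e i \<in> Idemp A \<and> e i \<odot>\<^bsub>X i\<^esub> c i = c i"
      using local_unit_module[OF UModD[OF assms] c(2)] by (intro bchoice) blast
    then obtain e where e: "\<And>i. i \<in> I \<Longrightarrow> e i \<in> Idemp A \<and> e i \<odot>\<^bsub>X i\<^esub> c i = c i" by blast
    have "\<exists>g \<in> Idemp A. \<forall>a \<in> e ` ?J. a \<otimes> g = a \<and> g \<otimes> a = a"
      by (rule local_units) (use c(3) e Idemp_closed in auto)
    then obtain g where g: "g \<in> Idemp A" "\<And>i. i \<in> ?J \<Longrightarrow> e i \<otimes> g = e i" by blast
    have "g \<odot>\<^bsub>X i\<^esub> c i = c i" if i: "i \<in> I" for i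
    proof (cases "c i = \<zero>\<^bsub>X i\<^esub>")
      case True
      then show ?thesis using right_module.ract_zero[OF rm[OF i] Idemp_closed[OF g(1)]] by simp
    next
      case False
      then have "e i \<otimes> g = e i" using g(2) i by simp
      then show ?thesis
        using right_module.ract_assoc[OF rm[OF i] _ Idemp_closed[OF g(1)] c(2)[OF i], of "e i"] e[OF i] Idemp_closed
        by metis
    qed
    then have "g \<odot>\<^bsub>ext_sum I X\<^esub> c = c"
      using c(1) by (auto simp: simps extensional_def)
    then show "\<exists>a \<in> carrier A. a \<odot>\<^bsub>ext_sum I X\<^esub> c = c" using Idemp_closed[OF g(1)] by blast
  qed
qed

lemma (in ring_with_local_units) transport_UMod:
  assumes "X \<in> UMod A" "inj_on j (carrier X)"
  shows "transport_mod j X \<in> UMod A"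
  unfolding UMod_def
proof (intro CollectI unitalI)
  show "right_module A (transport_mod j X)"
    by (rule transport_right_module[OF UMod_right_module[OF assms(1)] assms(2)])
  fix t assume "t \<in> carrier (transport_mod j X)"
  then obtain x where x: "t = j x" "x \<in> carrier X" by (auto simp: transport_mod_simps)
  obtain e where "e \<in> Idemp A" "e \<odot>\<^bsub>X\<^esub> x = x"
    using local_unit_module[OF UModD[OF assms(1)] x(2)] by blast
  then show "\<exists>a \<in> carrier A. a \<odot>\<^bsub>transport_mod j X\<^esub> t = t"
    using x Idemp_closed by (intro bexI[of _ e]) (simp_all add: transport_mod_ops[OF assms(2)])
qed

lemma (in ring_with_local_units) direct_sum_exists:
  fixes X :: "'u \<Rightarrow> ('a, 'u) module" and I :: "'u set"
  assumes inf: "infinite (UNIV :: 'u set)" and X: "\<And>i. i \<in> I \<Longrightarrow> X i \<in> UMod A"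
  obtains S \<iota> where "is_direct_sum A I X \<iota> S"
proof -
  let ?G = "\<lambda>i. add_monoid (X i)"
  let ?S = "sum_group I ?G"
  let ?E = "ext_sum I X"
  have grp: "group (?G i)" if "i \<in> I" for i
    using X[OF that] by (intro abelian_group.a_group UMod_abelian)
  interpret fam: group_family I ?G by (rule group_family.intro[OF grp])
  obtain j :: "('u \<Rightarrow> 'u) \<Rightarrow> 'u" where
    "inj_on j {c \<in> extensional I. finite {i \<in> I. c i \<noteq> \<zero>\<^bsub>X i\<^esub>}}"
    by (rule inj_finite_families[OF inf, where I = I and d = "\<lambda>i. \<zero>\<^bsub>X i\<^esub>"])
  moreover have "carrier ?S \<subseteq> {c \<in> extensional I. finite {i \<in> I. c i \<noteq> \<zero>\<^bsub>X i\<^esub>}}"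
    using carrier_sum_group[OF grp, of I] by (simp add: PiE_iff subset_iff)
  ultimately have j: "inj_on j (carrier ?S)" by (rule inj_on_subset)
  have E: "carrier ?E = carrier ?S" "add ?E = monoid.mult ?S" "\<zero>\<^bsub>?E\<^esub> = \<one>\<^bsub>?S\<^esub>"
    "\<And>a c. a \<odot>\<^bsub>?E\<^esub> c = (\<lambda>i \<in> I. a \<odot>\<^bsub>X i\<^esub> c i)"
    by (simp_all add: ext_sum_def Let_def)
  define D where "D = transport_mod j ?E"
  note ops = transport_mod_ops[of j ?E, folded D_def, unfolded E, OF j]
  have carD: "carrier D = j ` carrier ?S" by (simp add: D_def transport_mod_simps E)
  have DU: "D \<in> UMod A"
    unfolding D_def by (rule transport_UMod[OF ext_sum_UMod[OF X]]) (simp_all add: E j)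
  define \<iota> where "\<iota> i = (\<lambda>x \<in> carrier (X i). j (sum_single I ?G i x))" for i
  interpret D: abelian_group D by (rule UMod_abelian[OF DU])
  have \<iota>: "\<iota> i \<in> mhom A (X i) D" if i: "i \<in> I" for i
  proof -
    interpret Xi: right_module A "X i" by (rule UMod_right_module[OF X[OF i]])
    have cl: "sum_single I ?G i x \<in> carrier ?S" if "x \<in> carrier (X i)" for x
      using fam.sum_single_closed[OF i] that by simp
    have add: "sum_single I ?G i (x \<oplus>\<^bsub>X i\<^esub> y) = sum_single I ?G i x \<otimes>\<^bsub>?S\<^esub> sum_single I ?G i y"
      if "x \<in> carrier (X i)" "y \<in> carrier (X i)" for x y
    proof (rule ext)
      fix k
      show "sum_single I ?G i (x \<oplus>\<^bsub>X i\<^esub> y) k = (sum_single I ?G i x \<otimes>\<^bsub>?S\<^esub> sum_single I ?G i y) k"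
        using abelian_groupE(2,5)[OF UMod_abelian[OF X[of k]]]
        by (cases "k \<in> I"; cases "k = i") (simp_all add: sum_single_def)
    qed
    have act: "sum_single I ?G i (a \<odot>\<^bsub>X i\<^esub> x) = (\<lambda>k \<in> I. a \<odot>\<^bsub>X k\<^esub> sum_single I ?G i x k)"
      if "a \<in> carrier A" "x \<in> carrier (X i)" for a x
      using right_module.ract_zero[OF UMod_right_module[OF X] that(1)] by (auto simp: sum_single_def fun_eq_iff)
    show ?thesis
    proof (rule mhomI)
      show "\<iota> i \<in> hom (add_monoid (X i)) (add_monoid D)"
        using cl by (auto simp: hom_def \<iota>_def carD add ops)
    next
      fix a x assume "a \<in> carrier A" "x \<in> carrier (X i)"
      then show "\<iota> i (a \<odot>\<^bsub>X i\<^esub> x) = a \<odot>\<^bsub>D\<^esub> \<iota> i x"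
        using cl by (simp add: \<iota>_def act ops Xi.ract_closed)
    qed (simp add: \<iota>_def)
  qed
  let ?h = "\<lambda>c. gfinprod (add_monoid D) (\<lambda>i. \<iota> i (c i)) I"
  have h: "?h \<in> hom ?S (add_monoid D)"
    by (rule comm_group.hom_group_sum[OF D.a_comm_group mhom_hom[OF \<iota>] grp])
  have jh: "j \<in> hom ?S (add_monoid D)" by (auto simp: hom_def carD ops)
  \<comment> \<open>The canonical map and the transport \<open>j\<close> are homomorphisms that
    agree on one-coordinate families. Bijectivity of the canonical map is thereby that of
    \<open>j\<close>, which is injective with image \<open>carrier D\<close> by
    construction.\<close>
  have hj: "?h c = j c" if c: "c \<in> carrier ?S" for c
  proof (rule group_hom_eq_on_generate[of ?S "add_monoid D" ?h j])
    show "group_hom ?S (add_monoid D) ?h" "group_hom ?S (add_monoid D) j"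
      by (intro group_hom.intro group_hom_axioms.intro sum_group[OF grp] D.a_group h jh; assumption)+
    let ?Gen = "{sum_single I ?G i x | i x. i \<in> I \<and> x \<in> carrier (?G i)}"
    show "?Gen \<subseteq> carrier ?S" by (clarify; rule fam.sum_single_closed)
    show "c \<in> generate ?S ?Gen" unfolding fam.sum_single_generate by (rule c)
    fix s assume "s \<in> ?Gen"
    then obtain i x where ix: "s = sum_single I ?G i x" "i \<in> I" "x \<in> carrier (?G i)" by blast
    have "?h s = \<iota> i x"
      unfolding ix(1) by (rule fam.gfinprod_sum_single[OF D.a_comm_group mhom_hom[OF \<iota>] ix(2,3)])
    then show "?h s = j s" using ix(1,3) by (simp add: \<iota>_def)
  qed
  have "bij_betw ?h (carrier ?S) (carrier D)"
    using j carD hj by (simp add: bij_betw_def cong: inj_on_cong image_cong)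
  then have "?h \<in> iso ?S (add_monoid D)" using h by (simp add: iso_def)
  then have "is_direct_sum A I X \<iota> D"
    unfolding is_direct_sum_def using DU X \<iota> by blast
  then show thesis by (rule that)
qed

text \<open>There is one summand for each \<open>x\<close>, with \<open>e x\<close> a local unit of
  \<open>x\<close>, mapped to \<open>X\<close> by \<open>u \<mapsto> x u\<close>. The generator
  \<open>e x\<close> of that summand goes to \<open>x\<close>, which gives surjectivity. Indexing by
  \<open>carrier X\<close> keeps the index set inside the carrier type, as preservation of direct
  sums requires.\<close>

lemma (in ring_with_local_units) cover_exists:
  fixes X :: "('a, 'a) module"
  assumes inf: "infinite (UNIV :: 'a set)" and X: "X \<in> UMod A"
  obtains e \<iota> P q where "\<forall>x \<in> carrier X. e x \<in> Idemp A"
    and "is_direct_sum A (carrier X) (\<lambda>x. principal_mod A (e x)) \<iota> P"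
    and "q \<in> mhom A P X" and "q ` carrier P = carrier X"
proof -
  interpret X: unital_right_module A X by (rule UModD[OF X])
  have "\<exists>e. \<forall>x \<in> carrier X. e x \<in> Idemp A \<and> e x \<odot>\<^bsub>X\<^esub> x = x"
    using local_unit_module[OF UModD[OF X]] by (intro bchoice) blast
  then obtain e where e: "\<And>x. x \<in> carrier X \<Longrightarrow> e x \<in> Idemp A"
    "\<And>x. x \<in> carrier X \<Longrightarrow> e x \<odot>\<^bsub>X\<^esub> x = x" by blast
  let ?pr = "\<lambda>x. principal_mod A (e x)"
  have pr: "?pr x \<in> UMod A" if "x \<in> carrier X" for x
    by (rule principal_mod_UMod[OF e(1)[OF that]])
  obtain P \<iota> where ds: "is_direct_sum A (carrier X) ?pr \<iota> P"
    using direct_sum_exists[OF inf pr] .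
  note dsD = is_direct_sumD[OF ds]
  interpret P: right_module A P by (rule UMod_right_module[OF dsD(1)])
  have prc: "u \<in> carrier A" if "x \<in> carrier X" "u \<in> carrier (?pr x)" for x u
    using principal_mod_iff[OF e(1)[OF that(1)]] that(2) by blast
  have g: "(\<lambda>u. u \<odot>\<^bsub>X\<^esub> x) \<in> hom (add_monoid (?pr x)) (add_monoid X)" if x: "x \<in> carrier X" for x
    using prc[OF x] x by (intro homI) (simp_all del: carrier_principal_mod add: X.ract_closed X.ract_add_ring)
  obtain h where h: "h \<in> hom (add_monoid P) (add_monoid X)"
    and hi: "\<And>x u. \<lbrakk>x \<in> carrier X; u \<in> carrier (?pr x)\<rbrakk> \<Longrightarrow> h (\<iota> x u) = u \<odot>\<^bsub>X\<^esub> x"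
    using direct_sum_universal[OF ds X.abelian_group_axioms g] by blast
  \<comment> \<open>The universal property yields an additive map; its linearity is tested on the
    images of the summands.\<close>
  have act: "h (a \<odot>\<^bsub>P\<^esub> p) = a \<odot>\<^bsub>X\<^esub> h p" if a: "a \<in> carrier A" and p: "p \<in> carrier P" for a p
  proof (rule add_hom_eqI[OF P.abelian_group_axioms X.abelian_group_axioms _ _ direct_sum_generate[OF ds] _ p])
    show "(\<lambda>p. h (a \<odot>\<^bsub>P\<^esub> p)) \<in> hom (add_monoid P) (add_monoid X)"
      using Group.hom_compose[OF P.ract_hom[OF a] h] by (simp add: comp_def)
    show "(\<lambda>p. a \<odot>\<^bsub>X\<^esub> h p) \<in> hom (add_monoid P) (add_monoid X)"
      using Group.hom_compose[OF h X.ract_hom[OF a]] by (simp add: comp_def)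
    fix s assume "s \<in> {\<iota> x u | x u. x \<in> carrier X \<and> u \<in> carrier (?pr x)}"
    then obtain x u where s: "s = \<iota> x u" "x \<in> carrier X" "u \<in> carrier (?pr x)" by blast
    have ua: "u \<otimes> a \<in> carrier (?pr x)"
      using right_module.ract_closed[OF UMod_right_module[OF pr[OF s(2)]] a s(3)] by simp
    have "a \<odot>\<^bsub>P\<^esub> s = \<iota> x (u \<otimes> a)"
      using mhom_ract[OF dsD(3)[OF s(2)] a s(3)] s(1) by simp
    then have "h (a \<odot>\<^bsub>P\<^esub> s) = (u \<otimes> a) \<odot>\<^bsub>X\<^esub> x" using hi[OF s(2) ua] by simp
    also have "\<dots> = a \<odot>\<^bsub>X\<^esub> h s"
      using hi[OF s(2,3)] s(1) X.ract_assoc[OF prc[OF s(2,3)] a s(2)] by simp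
    finally show "h (a \<odot>\<^bsub>P\<^esub> s) = a \<odot>\<^bsub>X\<^esub> h s" .
  qed
  let ?q = "restrict h (carrier P)"
  have q: "?q \<in> mhom A P X"
    using h act by (intro mhomI) (auto simp: hom_def P.ract_closed)
  have "carrier X \<subseteq> ?q ` carrier P"
  proof
    fix x assume x: "x \<in> carrier X"
    note ex = Idemp_in_principal_mod[OF e(1)[OF x]]
    have "\<iota> x (e x) \<in> carrier P" by (rule mhom_closed[OF dsD(3)[OF x] ex])
    moreover have "x = ?q (\<iota> x (e x))" using calculation hi[OF x ex] e(2)[OF x] by simp
    ultimately show "x \<in> ?q ` carrier P" by (rule rev_image_eqI)
  qed
  then have "?q ` carrier P = carrier X" using mhom_closed[OF q] by blast
  moreover have "\<forall>x \<in> carrier X. e x \<in> Idemp A" using e(1) by blast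
  ultimately show thesis using ds q by (intro that)
qed

text \<open>Right exactness of \<open>F\<close> speaks about sequences of unital modules, so the
  kernel must be unital as well. It is, because a local unit of an element in \<open>P\<close> still
  fixes that element in the kernel.\<close>

lemma (in ring_with_local_units) kernel_exact_seq:
  assumes P: "P \<in> UMod A" and X: "X \<in> UMod A" and q: "q \<in> mhom A P X" "q ` carrier P = carrier X"
  obtains Q i where "right_exact_seq A Q P X i q"
proof -
  interpret P: right_module A P by (rule UMod_right_module[OF P])
  interpret X: right_module A X by (rule UMod_right_module[OF X])
  let ?H = "{p \<in> carrier P. q p = \<zero>\<^bsub>X\<^esub>}"
  let ?Q = "P\<lparr>carrier := ?H\<rparr>"
  interpret q: group_hom "add_monoid P" "add_monoid X" q
    by (rule add_group_homI[OF P.abelian_group_axioms X.abelian_group_axioms mhom_hom[OF q(1)]])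
  have "subgroup ?H (add_monoid P)"
    using q.subgroup_kernel by (simp add: kernel_def)
  then have "right_module A ?Q"
    by (rule P.restrict_right_module) (simp add: P.ract_closed mhom_ract[OF q(1)] X.ract_zero)
  then have Q: "?Q \<in> UMod A"
    unfolding UMod_def
  proof (intro CollectI unitalI)
    fix p assume "p \<in> carrier ?Q"
    then have "p \<in> carrier P" by simp
    from local_unit_module[OF UModD[OF P] this]
    show "\<exists>a \<in> carrier A. a \<odot>\<^bsub>?Q\<^esub> p = p" using Idemp_closed by auto
  qed
  have "(\<lambda>p \<in> ?H. p) \<in> mhom A ?Q P"
    using right_module.ract_closed[OF UMod_right_module[OF Q]] abelian_groupE(1)[OF UMod_abelian[OF Q]]
    by (intro mhomI homI) (simp_all)
  then have "right_exact_seq A ?Q P X (\<lambda>p \<in> ?H. p) q"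
    using P X Q q by (simp add: right_exact_seq_def)
  then show thesis by (rule that)
qed

section \<open>Continuous functors at the regular module\<close>

text \<open>The ring and the modules in the source of \<open>F\<close> share the type
  \<open>'u\<close>, so that \<open>reg A\<close> is an object on which \<open>F\<close> can be
  evaluated. Infinitude of \<open>'u\<close> provides the cover.\<close>

locale continuous_on_regular =
  A: ring_with_local_units K A + B: ring_with_local_units K B + F: continuous_functor A B F
  for K :: "('k, 'r) ring_scheme" and A :: "('k, 'u, 's) module_scheme"
    and B :: "('k, 'b, 't) module_scheme" and F :: "('u, 'u, 'b, 'v) mod_functor" +
  assumes inf: "infinite (UNIV :: 'u set)"
begin

abbreviation "M \<equiv> F_reg A F"
abbreviation "R \<equiv> reg A"
abbreviation "pr \<equiv> principal_mod A"

section \<open>Images of orbit maps under the functor\<close>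

lemma M_simps:
  "carrier M = carrier (fobj F R)" "\<zero>\<^bsub>M\<^esub> = \<zero>\<^bsub>fobj F R\<^esub>" "add M = add (fobj F R)"
  "smult M = smult (fobj F R)" "lsmult M a = farr F R R (orbit_map A R a)"
  by (simp_all add: F_reg_def module.defs bimodule.defs orbit_map_def)

lemma R_UMod: "R \<in> UMod A" by (rule A.reg_UMod)

lemma farr_closed: "\<lbrakk>X \<in> UMod A; Y \<in> UMod A; f \<in> mhom A X Y; z \<in> carrier (fobj F X)\<rbrakk> \<Longrightarrow>
    farr F X Y f z \<in> carrier (fobj F Y)"
  by (rule mhom_closed[OF F.farr_closed])

lemma farr_compose:
  "\<lbrakk>X \<in> UMod A; Y \<in> UMod A; Z \<in> UMod A; f \<in> mhom A X Y; g \<in> mhom A Y Z; z \<in> carrier (fobj F X)\<rbrakk> \<Longrightarrow>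
    farr F X Z (compose (carrier X) g f) z = farr F Y Z g (farr F X Y f z)"
  by (simp add: F.farr_comp compose_eq)

lemma orbit_mhom: "\<lbrakk>X \<in> UMod A; x \<in> carrier X\<rbrakk> \<Longrightarrow> orbit_map A X x \<in> mhom A R X"
  by (rule A.orbit_map_mhom[OF UMod_right_module])

lemma farr_orbit_closed:
  "\<lbrakk>X \<in> UMod A; x \<in> carrier X; y \<in> carrier M\<rbrakk> \<Longrightarrow> farr F R X (orbit_map A X x) y \<in> carrier (fobj F X)"
  by (simp add: farr_closed R_UMod orbit_mhom M_simps)

text \<open>Functoriality applied to the fact that \<open>f\<close> after the orbit map of
  \<open>x\<close> is the orbit map of \<open>f x\<close>. This is naturality of \<Theta> on pure
  tensors.\<close>

lemma farr_orbit_image: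
  assumes "X \<in> UMod A" "Y \<in> UMod A" "f \<in> mhom A X Y" "x \<in> carrier X" "y \<in> carrier M"
  shows "farr F R Y (orbit_map A Y (f x)) y = farr F X Y f (farr F R X (orbit_map A X x) y)"
  using farr_compose[OF R_UMod assms(1,2) orbit_mhom[OF assms(1,4)] assms(3)] assms(5)
    A.compose_orbit_map[OF UMod_right_module[OF assms(1)] assms(3,4)]
  by (simp add: M_simps)

text \<open>The orbit map of \<open>x a\<close> is left multiplication by \<open>a\<close> followed
  by the orbit map of \<open>x\<close>. This gives balancing of \<Theta> and, on the regular module,
  associativity of the left action.\<close>

lemma farr_orbit_ract:
  assumes "X \<in> UMod A" "a \<in> carrier A" "x \<in> carrier X" "y \<in> carrier M"
  shows "farr F R X (orbit_map A X (a \<odot>\<^bsub>X\<^esub> x)) y = farr F R X (orbit_map A X x) (lsmult M a y)"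
  using farr_orbit_image[OF R_UMod assms(1) orbit_mhom[OF assms(1,3)], of a y] assms
  by (simp add: M_simps orbit_map_def)

lemma farr_orbit_add:
  assumes "X \<in> UMod A" "x \<in> carrier X" "x' \<in> carrier X" "y \<in> carrier M"
  shows "farr F R X (orbit_map A X (x \<oplus>\<^bsub>X\<^esub> x')) y
    = farr F R X (orbit_map A X x) y \<oplus>\<^bsub>fobj F X\<^esub> farr F R X (orbit_map A X x') y"
proof -
  interpret X: right_module A X by (rule UMod_right_module[OF assms(1)])
  have "orbit_map A X (x \<oplus>\<^bsub>X\<^esub> x') = (\<lambda>a \<in> carrier R. orbit_map A X x a \<oplus>\<^bsub>X\<^esub> orbit_map A X x' a)"
    using assms by (auto simp: orbit_map_def X.ract_add)
  then show ?thesis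
    using F.additive[OF R_UMod assms(1) orbit_mhom[OF assms(1,2)] orbit_mhom[OF assms(1,3)]] assms(4)
    by (simp add: M_simps)
qed

lemma farr_add:
  assumes "X \<in> UMod A" "Y \<in> UMod A" "f \<in> mhom A X Y" "y \<in> carrier (fobj F X)" "y' \<in> carrier (fobj F X)"
  shows "farr F X Y f (y \<oplus>\<^bsub>fobj F X\<^esub> y') = farr F X Y f y \<oplus>\<^bsub>fobj F Y\<^esub> farr F X Y f y'"
  by (rule mhom_add[OF F.farr_closed[OF assms(1-3)] assms(4,5)])

lemma farr_ract:
  assumes "X \<in> UMod A" "Y \<in> UMod A" "f \<in> mhom A X Y" "b \<in> carrier B" "y \<in> carrier (fobj F X)"
  shows "farr F X Y f (b \<odot>\<^bsub>fobj F X\<^esub> y) = b \<odot>\<^bsub>fobj F Y\<^esub> farr F X Y f y"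
  by (rule mhom_ract[OF F.farr_closed[OF assms(1-3)] assms(4,5)])

lemma farr_proj_incl:
  assumes e: "e \<in> Idemp A" and z: "z \<in> carrier (fobj F (pr e))"
  shows "farr F R (pr e) (proj A e) (farr F (pr e) R (incl A e) z) = z"
proof -
  note p = A.principal_mod_UMod[OF e]
  have "compose (carrier (pr e)) (proj A e) (incl A e) = (\<lambda>x \<in> carrier (pr e). x)"
    using A.principal_mod_iff[OF e]
    by (auto simp del: carrier_principal_mod simp: compose_def incl_def proj_def fun_eq_iff)
  then show ?thesis
    using farr_compose[OF p R_UMod p A.incl_mhom[OF e] A.proj_mhom[OF e] z] z F.farr_id[OF p] by simp
qed

text \<open>Since \<open>f u = f (e u) = (f e) u\<close> on \<open>eA\<close>, the morphism
  \<open>f\<close> is the inclusion into \<open>A\<close> followed by the orbit map of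
  \<open>f e\<close>. Thus whatever comes from \<open>F(eA)\<close> already comes from
  \<open>F(A)\<close> through an orbit map.\<close>

lemma farr_principal:
  assumes e: "e \<in> Idemp A" and X: "X \<in> UMod A" and f: "f \<in> mhom A (pr e) X"
    and z: "z \<in> carrier (fobj F (pr e))"
  shows "farr F (pr e) X f z = farr F R X (orbit_map A X (f e)) (farr F (pr e) R (incl A e) z)"
proof -
  note p = A.principal_mod_UMod[OF e]
  note ee = A.Idemp_in_principal_mod[OF e]
  have fe: "f e \<in> carrier X" by (rule mhom_closed[OF f ee])
  have "compose (carrier (pr e)) (orbit_map A X (f e)) (incl A e) = f"
  proof (rule mhom_eqI[OF right_module.mhom_compose[OF UMod_right_module[OF p] A.incl_mhom[OF e] orbit_mhom[OF X fe]] f])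
    fix u assume u: "u \<in> carrier (pr e)"
    then have "u \<in> carrier A" "e \<otimes>\<^bsub>A\<^esub> u = u" using A.principal_mod_iff[OF e] by blast+
    then show "compose (carrier (pr e)) (orbit_map A X (f e)) (incl A e) u = f u"
      using mhom_ract[OF f _ ee, of u] u
      by (simp del: carrier_principal_mod add: compose_eq incl_def orbit_map_def)
  qed
  then show ?thesis
    using farr_compose[OF p R_UMod X A.incl_mhom[OF e] orbit_mhom[OF X fe] z] by simp
qed

text \<open>Preservation of direct sums makes the images of the \<open>F(eA)\<close> generate
  \<open>F(P)\<close>, right exactness makes \<open>F(q)\<close> surjective, and
  \<open>farr_principal\<close> rewrites the resulting generators of \<open>F(X)\<close> in terms of
  orbit maps.\<close>

lemma fobj_generate:
  assumes X: "X \<in> UMod A"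
  shows "generate (add_monoid (fobj F X))
    {farr F R X (orbit_map A X x) y | x y. x \<in> carrier X \<and> y \<in> carrier M} = carrier (fobj F X)"
    (is "generate ?FX ?S = _")
proof -
  obtain e \<iota> P q where e0: "\<forall>x \<in> carrier X. e x \<in> Idemp A"
    and ds: "is_direct_sum A (carrier X) (\<lambda>x. pr (e x)) \<iota> P"
    and q: "q \<in> mhom A P X" "q ` carrier P = carrier X"
    using A.cover_exists[OF inf X] .
  note e = bspec[OF e0]
  note dsD = is_direct_sumD[OF ds]
  obtain Q i where ex: "right_exact_seq A Q P X i q" using A.kernel_exact_seq[OF dsD(1) X q] .
  then have surj: "farr F P X q ` carrier (fobj F P) = carrier (fobj F X)"
    using F.right_exact[OF ex] by (simp add: right_exact_seq_def)
  interpret FX: abelian_group "fobj F X" by (rule UMod_abelian[OF F.fobj_closed[OF X]])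
  interpret FP: abelian_group "fobj F P" by (rule UMod_abelian[OF F.fobj_closed[OF dsD(1)]])
  interpret q: group_hom "add_monoid (fobj F P)" ?FX "farr F P X q"
    by (rule add_group_homI[OF FP.abelian_group_axioms FX.abelian_group_axioms
          mhom_hom[OF F.farr_closed[OF dsD(1) X q(1)]]])
  let ?D = "{farr F (pr (e x)) P (\<iota> x) z | x z. x \<in> carrier X \<and> z \<in> carrier (fobj F (pr (e x)))}"
  have gen: "generate (add_monoid (fobj F P)) ?D = carrier (fobj F P)"
    by (rule direct_sum_generate[OF F.preserves_direct_sums[OF ds]])
  have D: "?D \<subseteq> carrier (add_monoid (fobj F P))"
    using farr_closed[OF dsD(2) dsD(1) dsD(3)] by auto
  have genX: "generate ?FX (farr F P X q ` ?D) = carrier (fobj F X)"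
    using q.generate_img[OF D] unfolding gen surj .
  have "farr F P X q ` ?D \<subseteq> ?S"
  proof clarify
    fix x z assume x: "x \<in> carrier X" and z: "z \<in> carrier (fobj F (pr (e x)))"
    let ?f = "compose (carrier (pr (e x))) q (\<iota> x)"
    have f: "?f \<in> mhom A (pr (e x)) X"
      by (rule right_module.mhom_compose[OF UMod_right_module[OF dsD(2)[OF x]] dsD(3)[OF x] q(1)])
    have "farr F P X q (farr F (pr (e x)) P (\<iota> x) z) = farr F (pr (e x)) X ?f z"
      using farr_compose[OF dsD(2)[OF x] dsD(1) X dsD(3)[OF x] q(1) z] by simp
    also have "\<dots> = farr F R X (orbit_map A X (?f (e x))) (farr F (pr (e x)) R (incl A (e x)) z)"
      by (rule farr_principal[OF e[OF x] X f z])
    finally have "farr F P X q (farr F (pr (e x)) P (\<iota> x) z)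
      = farr F R X (orbit_map A X (?f (e x))) (farr F (pr (e x)) R (incl A (e x)) z)" .
    moreover have "?f (e x) \<in> carrier X"
      by (rule mhom_closed[OF f A.Idemp_in_principal_mod[OF e[OF x]]])
    moreover have "farr F (pr (e x)) R (incl A (e x)) z \<in> carrier M"
      unfolding M_simps by (rule farr_closed[OF dsD(2)[OF x] R_UMod A.incl_mhom[OF e[OF x]] z])
    ultimately show "\<exists>x' y. farr F P X q (farr F (pr (e x)) P (\<iota> x) z) = farr F R X (orbit_map A X x') y
      \<and> x' \<in> carrier X \<and> y \<in> carrier M" by blast
  qed
  from FX.add.mono_generate[OF this] have "carrier (fobj F X) \<subseteq> generate ?FX ?S"
    unfolding genX .
  moreover have "generate ?FX ?S \<subseteq> carrier (fobj F X)"
  proof (rule FX.add.generate_incl, clarify)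
    fix x y assume "x \<in> carrier X" "y \<in> carrier M"
    then show "farr F R X (orbit_map A X x) y \<in> carrier (fobj F X)" by (rule farr_orbit_closed[OF X])
  qed
  ultimately show ?thesis by blast
qed

section \<open>The bimodule \<open>F(A)\<close>\<close>

lemma M_abelian: "abelian_group M"
  by (rule abelian_group_cong[OF UMod_abelian[OF F.fobj_closed[OF R_UMod]]]) (simp_all add: M_simps)

text \<open>Left multiplications are the orbit maps of the regular module, so the axioms are the
  facts on orbit maps for \<open>X = R\<close>, and unitality is \<open>fobj_generate\<close>
  there.\<close>

lemma M_left: "unital_left_module A M"
proof -
  have cl: "lsmult M a x \<in> carrier M" if "a \<in> carrier A" "x \<in> carrier M" for a x
    using farr_orbit_closed[OF R_UMod, of a x] that by (simp add: M_simps)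
  moreover have "lsmult M (a \<oplus>\<^bsub>A\<^esub> b) x = lsmult M a x \<oplus>\<^bsub>M\<^esub> lsmult M b x"
    if "a \<in> carrier A" "b \<in> carrier A" "x \<in> carrier M" for a b x
    using farr_orbit_add[OF R_UMod, of a b x] that by (simp add: M_simps)
  moreover have "lsmult M a (x \<oplus>\<^bsub>M\<^esub> y) = lsmult M a x \<oplus>\<^bsub>M\<^esub> lsmult M a y"
    if "a \<in> carrier A" "x \<in> carrier M" "y \<in> carrier M" for a x y
    using farr_add[OF R_UMod R_UMod orbit_mhom[OF R_UMod, of a]] that by (simp add: M_simps)
  moreover have "lsmult M (a \<otimes>\<^bsub>A\<^esub> b) x = lsmult M a (lsmult M b x)"
    if "a \<in> carrier A" "b \<in> carrier A" "x \<in> carrier M" for a b x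
    using farr_orbit_ract[OF R_UMod, of b a x] that by (simp add: M_simps)
  moreover have "generate (add_monoid M) {lsmult M a x | a x. a \<in> carrier A \<and> x \<in> carrier M} = carrier M"
    using fobj_generate[OF R_UMod] generate_add_monoid_cong[of M "fobj F R"] by (simp add: M_simps)
  ultimately show ?thesis
    using M_abelian by (simp add: unital_left_module_def unital_left_module_axioms_def)
qed

text \<open>The right structure is that of \<open>fobj F R\<close>; the actions commute because
  \<open>F\<close> sends left multiplications to \<open>B\<close>-linear maps.\<close>

lemma M_bimodule: "unital_bimodule A B M"
proof -
  interpret FR: unital_right_module B "fobj F R" by (rule UModD[OF F.fobj_closed[OF R_UMod]])
  have "right_module B M"
    using M_abelian FR.ract_closed FR.ract_add_ring FR.ract_add FR.ract_assoc
    by (simp add: right_module_def right_module_axioms_def M_simps)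
  moreover have "generate (add_monoid M) {b \<odot>\<^bsub>M\<^esub> x | b x. b \<in> carrier B \<and> x \<in> carrier M} = carrier M"
    using FR.unital generate_add_monoid_cong[of M "fobj F R"] by (simp add: M_simps)
  ultimately have "unital_right_module B M"
    by (simp add: unital_right_module_def unital_right_module_axioms_def)
  moreover have "b \<odot>\<^bsub>M\<^esub> lsmult M a x = lsmult M a (b \<odot>\<^bsub>M\<^esub> x)"
    if "a \<in> carrier A" "b \<in> carrier B" "x \<in> carrier M" for a b x
    using farr_ract[OF R_UMod R_UMod orbit_mhom[OF R_UMod, of a] that(2), of x] that by (simp add: M_simps)
  ultimately show ?thesis
    using M_left by (simp add: unital_bimodule_def unital_bimodule_axioms_def)
qed

text \<open>With the bimodule structure in place the facts on tensor products become available; from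
  here on \<open>G\<close> is the functor of tensoring with \<open>F(A)\<close>.\<close>

interpretation bimodule_pair K A B M
  by (intro bimodule_pair.intro A.ring_with_local_units_axioms B.ring_with_local_units_axioms M_bimodule)

section \<open>The natural map from the tensor functor to \<open>F\<close>\<close>

definition Theta_mod :: "('u, 'u) module \<Rightarrow> ('u \<times> 'v \<Rightarrow>\<^sub>0 int) set \<Rightarrow> 'v" where
  "Theta_mod X = tensor_lift A X M (fobj F X) (\<lambda>x y. farr F R X (orbit_map A X x) y)"

lemma Theta_mod_balanced:
  assumes "X \<in> UMod A"
  shows "balanced_map A X M (fobj F X) (\<lambda>x y. farr F R X (orbit_map A X x) y)"
proof -
  interpret tensor_pair A X M by (rule tensor_pairI[OF assms])
  interpret FX: abelian_group "fobj F X" by (rule UMod_abelian[OF F.fobj_closed[OF assms]])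
  show ?thesis
  proof unfold_locales
    have "farr F R X (orbit_map A X x) (y \<oplus>\<^bsub>M\<^esub> y')
      = farr F R X (orbit_map A X x) y \<oplus>\<^bsub>fobj F X\<^esub> farr F R X (orbit_map A X x) y'"
      if "x \<in> carrier X" "y \<in> carrier M" "y' \<in> carrier M" for x y y'
      using farr_add[OF R_UMod assms orbit_mhom[OF assms that(1)]] that(2,3) by (simp add: M_simps)
    then show "balanced A X M (fobj F X) (\<lambda>x y. farr F R X (orbit_map A X x) y)"
      by (simp add: balanced_def farr_orbit_closed[OF assms] farr_orbit_add[OF assms] farr_orbit_ract[OF assms])
  qed
qed

lemma Theta_mod_pure:
  "\<lbrakk>X \<in> UMod A; x \<in> carrier X; y \<in> carrier M\<rbrakk> \<Longrightarrow>
    Theta_mod X (pure_tensor A X M x y) = farr F R X (orbit_map A X x) y"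
  unfolding Theta_mod_def by (rule balanced_map.lift_pure[OF Theta_mod_balanced])

lemma Theta_mod_hom: "X \<in> UMod A \<Longrightarrow> Theta_mod X \<in> hom (add_monoid (tensor_ag A X M)) (add_monoid (fobj F X))"
  unfolding Theta_mod_def by (rule balanced_map.lift_hom[OF Theta_mod_balanced])

lemma Theta_mod_mhom:
  assumes X: "X \<in> UMod A"
  shows "Theta_mod X \<in> mhom B (tensor A X M) (fobj F X)"
proof (rule mhomI)
  interpret tensor_pair A X M by (rule tensor_pairI[OF X])
  interpret FX: right_module B "fobj F X" by (rule UMod_right_module[OF F.fobj_closed[OF X]])
  show "Theta_mod X \<in> extensional (carrier (tensor A X M))"
    using balanced_map.lift_extensional[OF Theta_mod_balanced[OF X]] by (simp add: Theta_mod_def)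
  show "Theta_mod X \<in> hom (add_monoid (tensor A X M)) (add_monoid (fobj F X))"
    unfolding hom_from_tensor by (rule Theta_mod_hom[OF X])
  fix b t assume b: "b \<in> carrier B" and t: "t \<in> carrier (tensor A X M)"
  show "Theta_mod X (b \<odot>\<^bsub>tensor A X M\<^esub> t) = b \<odot>\<^bsub>fobj F X\<^esub> Theta_mod X t"
  proof (rule tensor_hom_eqI[OF FX.abelian_group_axioms, where f = "\<lambda>t. Theta_mod X (b \<odot>\<^bsub>tensor A X M\<^esub> t)"
        and g = "\<lambda>t. b \<odot>\<^bsub>fobj F X\<^esub> Theta_mod X t"])
    show "(\<lambda>t. Theta_mod X (b \<odot>\<^bsub>tensor A X M\<^esub> t)) \<in> hom (add_monoid T) (add_monoid (fobj F X))"
      using Group.hom_compose[OF tensor_ract_hom[OF X b] Theta_mod_hom[OF X]] by (simp add: comp_def)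
    show "(\<lambda>t. b \<odot>\<^bsub>fobj F X\<^esub> Theta_mod X t) \<in> hom (add_monoid T) (add_monoid (fobj F X))"
      using Group.hom_compose[OF Theta_mod_hom[OF X] FX.ract_hom[OF b]] by (simp add: comp_def)
    fix x y assume x: "x \<in> carrier X" and y: "y \<in> carrier M"
    have y': "y \<in> carrier (fobj F R)" using y by (simp add: M_simps)
    have by': "b \<odot>\<^bsub>M\<^esub> y \<in> carrier M" by (rule M.right.ract_closed[OF b y])
    show "Theta_mod X (b \<odot>\<^bsub>tensor A X M\<^esub> pure x y) = b \<odot>\<^bsub>fobj F X\<^esub> Theta_mod X (pure x y)"
      unfolding tensor_ract_pure[OF X b x y] Theta_mod_pure[OF X x y] Theta_mod_pure[OF X x by']
      using farr_ract[OF R_UMod X orbit_mhom[OF X x] b y'] by (simp add: M_simps)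
  next
    show "t \<in> carrier T" using t by simp
  qed
qed

lemma Theta_mod_natural:
  assumes X: "X \<in> UMod A" and Y: "Y \<in> UMod A" and f: "f \<in> mhom A X Y" and t: "t \<in> carrier (tensor_ag A X M)"
  shows "Theta_mod Y (farr G X Y f t) = farr F X Y f (Theta_mod X t)"
proof -
  interpret tensor_pair A X M by (rule tensor_pairI[OF X])
  show ?thesis
  proof (rule tensor_hom_eqI[OF UMod_abelian[OF F.fobj_closed[OF Y]],
        where f = "\<lambda>t. Theta_mod Y (farr G X Y f t)" and g = "\<lambda>t. farr F X Y f (Theta_mod X t)"])
    show "(\<lambda>t. Theta_mod Y (farr G X Y f t)) \<in> hom (add_monoid T) (add_monoid (fobj F Y))"
      using Group.hom_compose[OF G_arr_hom[OF X Y f] Theta_mod_hom[OF Y]] by (simp add: comp_def)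
    show "(\<lambda>t. farr F X Y f (Theta_mod X t)) \<in> hom (add_monoid T) (add_monoid (fobj F Y))"
      using Group.hom_compose[OF Theta_mod_hom[OF X] mhom_hom[OF F.farr_closed[OF X Y f]]] by (simp add: comp_def)
    fix x y assume x: "x \<in> carrier X" and y: "y \<in> carrier M"
    show "Theta_mod Y (farr G X Y f (pure x y)) = farr F X Y f (Theta_mod X (pure x y))"
      unfolding G_arr_pure[OF X Y f x y] Theta_mod_pure[OF X x y] Theta_mod_pure[OF Y mhom_closed[OF f x] y]
      by (rule farr_orbit_image[OF X Y f x y])
  qed (rule t)
qed

lemma Theta_mod_surj:
  assumes X: "X \<in> UMod A"
  shows "Theta_mod X ` carrier (tensor_ag A X M) = carrier (fobj F X)"
proof -
  interpret tensor_pair A X M by (rule tensor_pairI[OF X])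
  show ?thesis
  proof (rule add_hom_surjI[OF T_abelian UMod_abelian[OF F.fobj_closed[OF X]] Theta_mod_hom[OF X] fobj_generate[OF X]], clarify)
    fix x y assume xy: "x \<in> carrier X" "y \<in> carrier M"
    show "farr F R X (orbit_map A X x) y \<in> Theta_mod X ` carrier T"
      unfolding Theta_mod_pure[OF X xy, symmetric] by (rule imageI[OF pure_closed[OF xy]])
  qed
qed

text \<open>For \<open>u \<in> eA\<close> one has \<open>e u = u\<close>, so the orbit map of
  \<open>u\<close> into \<open>eA\<close> is left multiplication by \<open>u\<close> on
  \<open>A\<close> followed by \<open>\<pi>\<^sub>e\<close>. Applying \<open>F\<close> gives
  \<open>F(\<pi>\<^sub>e)(u y)\<close>, the value of the original map at
  \<open>u \<otimes> y\<close>.\<close>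

lemma Theta_eq:
  assumes e: "e \<in> Idemp A"
  shows "Theta A F e = Theta_mod (pr e)"
proof -
  note p = A.principal_mod_UMod[OF e]
  interpret tensor_pair A "pr e" M by (rule tensor_pairI[OF p])
  have out: "balanced_map A (pr e) M M (\<lambda>u x. lsmult M u x)"
    by unfold_locales
      (use A.principal_mod_iff[OF e] M.left.lact_closed M.left.lact_add_ring M.left.lact_add M.left.lact_assoc
        in \<open>simp add: balanced_def del: carrier_principal_mod\<close>)
  note proj = A.proj_mhom[OF e]
  have outh: "tens_out A M e \<in> hom (add_monoid T) (add_monoid M)"
    unfolding tens_out_def by (rule balanced_map.lift_hom[OF out])
  have eq: "farr F R (pr e) (proj A e) (tens_out A M e t) = Theta_mod (pr e) t" if t: "t \<in> carrier T" for t
  proof (rule tensor_hom_eqI[OF UMod_abelian[OF F.fobj_closed[OF p]], where g = "Theta_mod (pr e)"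
        and f = "\<lambda>t. farr F R (pr e) (proj A e) (tens_out A M e t)"])
    have "farr F R (pr e) (proj A e) \<in> hom (add_monoid M) (add_monoid (fobj F (pr e)))"
      using mhom_hom[OF F.farr_closed[OF R_UMod p proj]] by (simp add: hom_def M_simps)
    from Group.hom_compose[OF outh this]
    show "(\<lambda>t. farr F R (pr e) (proj A e) (tens_out A M e t)) \<in> hom (add_monoid T) (add_monoid (fobj F (pr e)))"
      by (simp add: comp_def)
    fix u y assume u: "u \<in> carrier (pr e)" and y: "y \<in> carrier M"
    have uA: "u \<in> carrier A" "e \<otimes>\<^bsub>A\<^esub> u = u" using A.principal_mod_iff[OF e] u by blast+
    then have "u \<in> carrier R" "proj A e u = u" by (simp_all add: proj_def)
    then have "farr F R (pr e) (orbit_map A (pr e) u) y = farr F R (pr e) (proj A e) (lsmult M u y)"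
      using farr_orbit_image[OF R_UMod p proj _ y, of u] by (simp add: M_simps)
    then show "farr F R (pr e) (proj A e) (tens_out A M e (pure u y)) = Theta_mod (pr e) (pure u y)"
      using balanced_map.lift_pure[OF out u y] Theta_mod_pure[OF p u y] by (simp add: tens_out_def)
  qed (rule Theta_mod_hom[OF p], rule t)
  show ?thesis
  proof (rule extensionalityI[of _ "carrier T"])
    show "Theta A F e \<in> extensional (carrier T)" by (simp add: Theta_def)
    show "Theta_mod (pr e) \<in> extensional (carrier T)"
      using mhom_extensional[OF Theta_mod_mhom[OF p]] by simp
    show "Theta A F e t = Theta_mod (pr e) t" if "t \<in> carrier T" for t
      using eq[OF that] that by (simp add: Theta_def compose_eq)
  qed
qed

section \<open>Invertibility on the modules \<open>eA\<close>\<close>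

lemma Upsilon_apply:
  assumes e: "e \<in> Idemp A" and z: "z \<in> carrier (fobj F (pr e))"
  shows "farr F (pr e) R (incl A e) z \<in> carrier M"
    and "Upsilon A F e z = pure_tensor A (pr e) M e (farr F (pr e) R (incl A e) z)"
proof -
  show c: "farr F (pr e) R (incl A e) z \<in> carrier M"
    unfolding M_simps by (rule farr_closed[OF A.principal_mod_UMod[OF e] R_UMod A.incl_mhom[OF e] z])
  then show "Upsilon A F e z = pure_tensor A (pr e) M e (farr F (pr e) R (incl A e) z)"
    using z by (simp add: Upsilon_def compose_eq tens_in_def)
qed

lemma Upsilon_closed:
  assumes e: "e \<in> Idemp A" and z: "z \<in> carrier (fobj F (pr e))"
  shows "Upsilon A F e z \<in> carrier (tensor_ag A (pr e) M)"
  unfolding Upsilon_apply(2)[OF assms]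
  by (rule tensor_pair.pure_closed[OF tensor_pairI[OF A.principal_mod_UMod[OF e]]
        A.Idemp_in_principal_mod[OF e] Upsilon_apply(1)[OF assms]])

text \<open>Additivity is enough for comparison on pure tensors; the \<open>B\<close>-linearity of
  the extended map is inherited later from its inverse.\<close>

lemma Upsilon_hom:
  assumes e: "e \<in> Idemp A"
  shows "Upsilon A F e \<in> hom (add_monoid (fobj F (pr e))) (add_monoid (tensor_ag A (pr e) M))"
proof (rule homI)
  note p = A.principal_mod_UMod[OF e]
  interpret tensor_pair A "pr e" M by (rule tensor_pairI[OF p])
  interpret Fp: abelian_group "fobj F (pr e)" by (rule UMod_abelian[OF F.fobj_closed[OF p]])
  fix z w assume "z \<in> carrier (add_monoid (fobj F (pr e)))" "w \<in> carrier (add_monoid (fobj F (pr e)))"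
  then have zw: "z \<in> carrier (fobj F (pr e))" "w \<in> carrier (fobj F (pr e))" by simp_all
  note ee = A.Idemp_in_principal_mod[OF e]
  have "Upsilon A F e (z \<oplus>\<^bsub>fobj F (pr e)\<^esub> w) = Upsilon A F e z \<oplus>\<^bsub>T\<^esub> Upsilon A F e w"
    unfolding Upsilon_apply(2)[OF e zw(1)] Upsilon_apply(2)[OF e zw(2)] Upsilon_apply(2)[OF e Fp.a_closed[OF zw]]
      farr_add[OF p R_UMod A.incl_mhom[OF e] zw] M_simps(3)[symmetric]
    by (rule pure_add_right[OF ee Upsilon_apply(1)[OF e zw(1)] Upsilon_apply(1)[OF e zw(2)]])
  then show "Upsilon A F e (z \<otimes>\<^bsub>add_monoid (fobj F (pr e))\<^esub> w)
    = Upsilon A F e z \<otimes>\<^bsub>add_monoid T\<^esub> Upsilon A F e w" by simp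
qed (use Upsilon_closed[OF e] in simp)

text \<open>The orbit map of \<open>e\<close> in \<open>eA\<close> is the projection
  \<open>\<pi>\<^sub>e\<close>, so the composite is \<open>F(\<pi>\<^sub>e)\<close> after
  \<open>F(\<tau>\<^sub>e)\<close>, the image of the identity of \<open>eA\<close>.\<close>

lemma Theta_mod_Upsilon:
  assumes e: "e \<in> Idemp A" and z: "z \<in> carrier (fobj F (pr e))"
  shows "Theta_mod (pr e) (Upsilon A F e z) = z"
proof -
  note p = A.principal_mod_UMod[OF e]
  have "orbit_map A (pr e) e = proj A e"
    by (simp add: orbit_map_def proj_def)
  then show ?thesis
    unfolding Upsilon_apply(2)[OF assms] Theta_mod_pure[OF p A.Idemp_in_principal_mod[OF e] Upsilon_apply(1)[OF assms]]
    using farr_proj_incl[OF assms] by simp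
qed

text \<open>The inclusion turns the orbit map of \<open>u\<close> in \<open>eA\<close> into left
  multiplication by \<open>u\<close> on \<open>A\<close>. So \<open>u \<otimes> y\<close> is sent to
  \<open>e \<otimes> u y = e u \<otimes> y = u \<otimes> y\<close>.\<close>

lemma Upsilon_Theta_mod:
  assumes e: "e \<in> Idemp A" and t: "t \<in> carrier (tensor_ag A (pr e) M)"
  shows "Upsilon A F e (Theta_mod (pr e) t) = t"
proof -
  note p = A.principal_mod_UMod[OF e]
  interpret tensor_pair A "pr e" M by (rule tensor_pairI[OF p])
  note ee = A.Idemp_in_principal_mod[OF e]
  show ?thesis
  proof (rule tensor_hom_eqI[OF T_abelian, where f = "\<lambda>t. Upsilon A F e (Theta_mod (pr e) t)" and g = "\<lambda>t. t"])
    show "(\<lambda>t. Upsilon A F e (Theta_mod (pr e) t)) \<in> hom (add_monoid T) (add_monoid T)"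
      using Group.hom_compose[OF Theta_mod_hom[OF p] Upsilon_hom[OF e]] by (simp add: comp_def)
    show "(\<lambda>t. t) \<in> hom (add_monoid T) (add_monoid T)" by (simp add: hom_def)
    fix u y assume u: "u \<in> carrier (pr e)" and y: "y \<in> carrier M"
    have uA: "u \<in> carrier A" "e \<otimes>\<^bsub>A\<^esub> u = u" using A.principal_mod_iff[OF e] u by blast+
    have "farr F (pr e) R (incl A e) (farr F R (pr e) (orbit_map A (pr e) u) y)
        = farr F R R (orbit_map A R (incl A e u)) y"
      using farr_orbit_image[OF p R_UMod A.incl_mhom[OF e] u y] by simp
    also have "\<dots> = lsmult M u y" using u by (simp add: incl_def M_simps del: carrier_principal_mod)
    finally have "Upsilon A F e (Theta_mod (pr e) (pure u y)) = pure e (lsmult M u y)"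
      unfolding Theta_mod_pure[OF p u y] Upsilon_apply(2)[OF e farr_orbit_closed[OF p u y]] by simp
    also have "\<dots> = pure u y" using pure_balanced[OF uA(1) ee y] uA(2) by simp
    finally show "Upsilon A F e (Theta_mod (pr e) (pure u y)) = pure u y" .
  qed (rule t)
qed

text \<open>As \<open>F(P)\<close> is the direct sum of the \<open>F(X i)\<close>, the maps
  \<Upsilon> on the summands, followed by \<open>G(\<iota> i)\<close>, assemble to an additive map
  \<open>h\<close> on \<open>F(P)\<close>. Naturality of \<Theta> along \<open>\<iota> i\<close>
  shows that \<open>h\<close> is a left inverse.\<close>

lemma Theta_mod_direct_sum_inj:
  fixes I :: "'u set"
  assumes ds: "is_direct_sum A I X \<iota> P" and e: "\<And>i. i \<in> I \<Longrightarrow> e i \<in> Idemp A" "\<And>i. i \<in> I \<Longrightarrow> X i = pr (e i)"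
  shows "inj_on (Theta_mod P) (carrier (tensor_ag A P M))"
proof -
  note dsD = is_direct_sumD[OF ds]
  interpret tensor_pair A P M by (rule tensor_pairI[OF dsD(1)])
  let ?g = "\<lambda>i w. farr G (X i) P (\<iota> i) (Upsilon A F (e i) w)"
  have g: "?g i \<in> hom (add_monoid (fobj F (X i))) (add_monoid T)" if i: "i \<in> I" for i
    using Group.hom_compose[OF Upsilon_hom[OF e(1)[OF i], folded e(2)[OF i]] G_arr_hom[OF dsD(2)[OF i] dsD(1) dsD(3)[OF i]]]
    by (simp add: comp_def)
  from direct_sum_universal[OF F.preserves_direct_sums[OF ds] T_abelian g]
  obtain h where h: "h \<in> hom (add_monoid (fobj F P)) (add_monoid T)"
    and hi: "\<forall>i \<in> I. \<forall>w \<in> carrier (fobj F (X i)). h (farr F (X i) P (\<iota> i) w) = ?g i w" by blast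
  have hTheta: "(\<lambda>t. h (Theta_mod P t)) \<in> hom (add_monoid T) (add_monoid T)"
    using Group.hom_compose[OF Theta_mod_hom[OF dsD(1)] h] by (simp add: comp_def)
  have "h (Theta_mod P t) = t" if t: "t \<in> carrier T" for t
  proof (rule tensor_hom_eqI[OF T_abelian hTheta, where g = "\<lambda>t. t"])
    show "(\<lambda>t. t) \<in> hom (add_monoid T) (add_monoid T)" by (simp add: hom_def)
    fix p y assume p: "p \<in> carrier P" and y: "y \<in> carrier M"
    show "h (Theta_mod P (pure p y)) = pure p y"
    \<comment> \<open>For fixed \<open>y\<close> both sides are additive in \<open>p\<close>, so
      \<open>p\<close> may be taken from the image of a single summand.\<close>
    proof (rule add_hom_eqI[OF X.abelian_group_axioms T_abelian _ _ direct_sum_generate[OF ds] _ p])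
      show left: "(\<lambda>p. pure p y) \<in> hom (add_monoid P) (add_monoid T)"
        using y by (simp add: hom_def pure_closed pure_add_left)
      show "(\<lambda>p. h (Theta_mod P (pure p y))) \<in> hom (add_monoid P) (add_monoid T)"
        using Group.hom_compose[OF left hTheta] by (simp add: comp_def)
      fix s assume "s \<in> {\<iota> i u | i u. i \<in> I \<and> u \<in> carrier (X i)}"
      then obtain i u where s: "s = \<iota> i u" and i: "i \<in> I" and u: "u \<in> carrier (X i)" by blast
      note Xi = dsD(2)[OF i]
      note arr = G_arr_pure[OF Xi dsD(1) dsD(3)[OF i] u y]
      interpret Xi: tensor_pair A "X i" M by (rule tensor_pairI[OF Xi])
      have puy: "Xi.pure u y \<in> carrier Xi.T" by (rule Xi.pure_closed[OF u y])
      have "Theta_mod P (pure s y) = farr F (X i) P (\<iota> i) (Theta_mod (X i) (Xi.pure u y))"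
        unfolding s arr[symmetric] by (rule Theta_mod_natural[OF Xi dsD(1) dsD(3)[OF i] puy])
      moreover have "Theta_mod (X i) (Xi.pure u y) \<in> carrier (fobj F (X i))"
        using Theta_mod_surj[OF Xi] puy by blast
      ultimately have "h (Theta_mod P (pure s y)) = ?g i (Theta_mod (X i) (Xi.pure u y))"
        using hi i by simp
      also have "Upsilon A F (e i) (Theta_mod (X i) (Xi.pure u y)) = Xi.pure u y"
        using Upsilon_Theta_mod[OF e(1)[OF i]] puy unfolding e(2)[OF i] .
      finally show "h (Theta_mod P (pure s y)) = pure s y" unfolding arr s .
    qed
  qed (rule t)
  then show ?thesis by (rule inj_on_inverseI)
qed


lemma Theta_mod_inj:
  assumes X: "X \<in> UMod A"
  shows "inj_on (Theta_mod X) (carrier (tensor_ag A X M))"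
proof -
  obtain e \<iota> P q where e: "\<forall>x \<in> carrier X. e x \<in> Idemp A"
    and ds: "is_direct_sum A (carrier X) (\<lambda>x. pr (e x)) \<iota> P"
    and q: "q \<in> mhom A P X" "q ` carrier P = carrier X"
    using A.cover_exists[OF inf X] .
  note P = is_direct_sumD(1)[OF ds]
  obtain Q i where ex: "right_exact_seq A Q P X i q" using A.kernel_exact_seq[OF P X q] .
  then have Q: "Q \<in> UMod A" and i: "i \<in> mhom A Q P" and qi: "i ` carrier Q = {p \<in> carrier P. q p = \<zero>\<^bsub>X\<^esub>}"
    by (simp_all add: right_exact_seq_def)
  have FP: "farr F Q P i ` carrier (fobj F Q) = {z \<in> carrier (fobj F P). farr F P X q z = \<zero>\<^bsub>fobj F X\<^esub>}"
    using F.right_exact[OF ex] by (simp add: right_exact_seq_def)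
  interpret X: tensor_pair A X M by (rule tensor_pairI[OF X])
  interpret P: tensor_pair A P M by (rule tensor_pairI[OF P])
  interpret Q: tensor_pair A Q M by (rule tensor_pairI[OF Q])
  have FX: "abelian_group (fobj F X)" by (rule UMod_abelian[OF F.fobj_closed[OF X]])
  have inj: "inj_on (Theta_mod P) (carrier P.T)"
    by (rule Theta_mod_direct_sum_inj[OF ds]) (use e in auto)
  have Gq: "farr G P X q ` carrier P.T = carrier X.T"
  proof (rule add_hom_surjI[OF P.T_abelian X.T_abelian G_arr_hom[OF P X q(1)] X.pure_generate], clarify)
    fix x y assume x: "x \<in> carrier X" and y: "y \<in> carrier M"
    then obtain p where p: "p \<in> carrier P" "x = q p" using q(2) by blast
    show "X.pure x y \<in> farr G P X q ` carrier P.T"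
      unfolding p(2) G_arr_pure[OF P X q(1) p(1) y, symmetric]
      by (rule imageI[OF P.pure_closed[OF p(1) y]])
  qed
  have Gqi: "farr G P X q (farr G Q P i s) = \<zero>\<^bsub>X.T\<^esub>" if s: "s \<in> carrier Q.T" for s
  proof (rule Q.tensor_hom_eqI[OF X.T_abelian, where f = "\<lambda>s. farr G P X q (farr G Q P i s)" and g = "\<lambda>_. \<zero>\<^bsub>X.T\<^esub>"])
    show "(\<lambda>s. farr G P X q (farr G Q P i s)) \<in> hom (add_monoid Q.T) (add_monoid X.T)"
      using Group.hom_compose[OF G_arr_hom[OF Q P i] G_arr_hom[OF P X q(1)]] by (simp add: comp_def)
    show "(\<lambda>_. \<zero>\<^bsub>X.T\<^esub>) \<in> hom (add_monoid Q.T) (add_monoid X.T)" by (simp add: hom_def)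
    fix x y assume x: "x \<in> carrier Q" and y: "y \<in> carrier M"
    have ix: "i x \<in> carrier P" "q (i x) = \<zero>\<^bsub>X\<^esub>" using qi x by auto
    \<comment> \<open>Additivity in the first argument gives \<open>0 \<otimes> y = 0\<close>, which
      is what remains after \<open>q (i x) = 0\<close>.\<close>
    have "(\<lambda>x. X.pure x y) \<in> hom (add_monoid X) (add_monoid X.T)"
      using y by (simp add: hom_def X.pure_closed X.pure_add_left)
    from add_hom_zero[OF X.X.abelian_group_axioms X.T_abelian this]
    show "farr G P X q (farr G Q P i (Q.pure x y)) = \<zero>\<^bsub>X.T\<^esub>"
      unfolding G_arr_pure[OF Q P i x y] G_arr_pure[OF P X q(1) ix(1) y] ix(2) .
  qed (rule s)
  show ?thesis
  proof (rule add_hom_injI[OF X.T_abelian FX Theta_mod_hom[OF X]])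
    \<comment> \<open>Lift \<open>t\<close> to \<open>t'\<close> over \<open>P\<close>. Its image in
      \<open>F(P)\<close> is killed by \<open>F(q)\<close>, so it comes from \<open>F(Q)\<close> and
      from there lifts to \<open>s'\<close>. Naturality and injectivity over \<open>P\<close> force
      \<open>t' = G(i)(s')\<close>, so \<open>t\<close> is a value of the zero map
      \<open>G(q) \<circ> G(i)\<close>.\<close>
    fix t assume t: "t \<in> carrier X.T" "Theta_mod X t = \<zero>\<^bsub>fobj F X\<^esub>"
    then obtain t' where t': "t' \<in> carrier P.T" "t = farr G P X q t'" using Gq by blast
    have "farr F P X q (Theta_mod P t') = \<zero>\<^bsub>fobj F X\<^esub>"
      using Theta_mod_natural[OF P X q(1) t'(1)] t(2) t'(2) by simp
    moreover have "Theta_mod P t' \<in> carrier (fobj F P)" using Theta_mod_surj[OF P] t'(1) by blast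
    ultimately obtain s where s: "s \<in> carrier (fobj F Q)" "Theta_mod P t' = farr F Q P i s"
      using FP by blast
    then obtain s' where s': "s' \<in> carrier Q.T" "s = Theta_mod Q s'" using Theta_mod_surj[OF Q] by blast
    have Gs: "farr G Q P i s' \<in> carrier P.T"
      using hom_in_carrier[OF G_arr_hom[OF Q P i]] s'(1) by simp
    have "Theta_mod P t' = Theta_mod P (farr G Q P i s')"
      using s(2) s'(2) Theta_mod_natural[OF Q P i s'(1)] by simp
    then have "t' = farr G Q P i s'" by (rule inj_onD[OF inj _ t'(1) Gs])
    then show "t = \<zero>\<^bsub>X.T\<^esub>" using t'(2) Gqi[OF s'(1)] by simp
  qed
qed

text \<open>The two restrictions make the family and each of its components extensional, so that
  uniqueness can be asserted as equality of functions.\<close>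

definition Upsilon_mod :: "('u, 'u) module \<Rightarrow> 'v \<Rightarrow> ('u \<times> 'v \<Rightarrow>\<^sub>0 int) set" where
  "Upsilon_mod = (\<lambda>X \<in> UMod A. \<lambda>z \<in> carrier (fobj F X). inv_into (carrier (tensor_ag A X M)) (Theta_mod X) z)"

lemma Upsilon_mod_closed: "\<lbrakk>X \<in> UMod A; z \<in> carrier (fobj F X)\<rbrakk> \<Longrightarrow> Upsilon_mod X z \<in> carrier (tensor_ag A X M)"
  using inv_into_into[of z "Theta_mod X" "carrier (tensor_ag A X M)"] by (simp add: Upsilon_mod_def Theta_mod_surj)

lemma Theta_mod_Upsilon_mod: "\<lbrakk>X \<in> UMod A; z \<in> carrier (fobj F X)\<rbrakk> \<Longrightarrow> Theta_mod X (Upsilon_mod X z) = z"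
  using f_inv_into_f[of z "Theta_mod X" "carrier (tensor_ag A X M)"] by (simp add: Upsilon_mod_def Theta_mod_surj)

text \<open>Injectivity of \<Theta> in usable form: a value of the inverse is identified by applying
  \<Theta>. Linearity, naturality and agreement with the given \<Upsilon> on \<open>eA\<close> are
  all transferred this way.\<close>

lemma Upsilon_mod_eqI: "\<lbrakk>X \<in> UMod A; t \<in> carrier (tensor_ag A X M); Theta_mod X t = z\<rbrakk> \<Longrightarrow> Upsilon_mod X z = t"
  using Theta_mod_surj[of X] by (auto simp: Upsilon_mod_def inv_into_f_f[OF Theta_mod_inj])

lemma Upsilon_mod_principal:
  assumes e: "e \<in> Idemp A"
  shows "Upsilon_mod (pr e) = Upsilon A F e"
proof (rule extensionalityI[of _ "carrier (fobj F (pr e))"])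
  note p = A.principal_mod_UMod[OF e]
  show "Upsilon_mod (pr e) \<in> extensional (carrier (fobj F (pr e)))" using p by (simp add: Upsilon_mod_def)
  show "Upsilon A F e \<in> extensional (carrier (fobj F (pr e)))" by (simp add: Upsilon_def)
  fix z assume z: "z \<in> carrier (fobj F (pr e))"
  show "Upsilon_mod (pr e) z = Upsilon A F e z"
    by (rule Upsilon_mod_eqI[OF p Upsilon_closed[OF e z] Theta_mod_Upsilon[OF e z]])
qed

lemma Upsilon_mod_mhom:
  assumes X: "X \<in> UMod A"
  shows "Upsilon_mod X \<in> mhom B (fobj F X) (tensor A X M)"
proof (rule mhomI)
  interpret tensor_pair A X M by (rule tensor_pairI[OF X])
  interpret TX: right_module B "tensor A X M" by (rule UMod_right_module[OF tensor_UMod[OF X]])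
  note Theta_mod_add = mhom_add[OF Theta_mod_mhom[OF X], unfolded carrier_tensor add_tensor]
  note Theta_mod_ract = mhom_ract[OF Theta_mod_mhom[OF X], unfolded carrier_tensor]
  show "Upsilon_mod X \<in> extensional (carrier (fobj F X))" using X by (simp add: Upsilon_mod_def)
  show "Upsilon_mod X \<in> hom (add_monoid (fobj F X)) (add_monoid (tensor A X M))"
  proof (rule homI)
    fix z w assume "z \<in> carrier (add_monoid (fobj F X))" "w \<in> carrier (add_monoid (fobj F X))"
    then have zw: "z \<in> carrier (fobj F X)" "w \<in> carrier (fobj F X)" by simp_all
    have "Upsilon_mod X (z \<oplus>\<^bsub>fobj F X\<^esub> w) = Upsilon_mod X z \<oplus>\<^bsub>T\<^esub> Upsilon_mod X w"
      by (rule Upsilon_mod_eqI[OF X T.a_closed])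
        (simp_all add: Upsilon_mod_closed X zw Theta_mod_add Theta_mod_Upsilon_mod)
    then show "Upsilon_mod X (z \<otimes>\<^bsub>add_monoid (fobj F X)\<^esub> w)
      = Upsilon_mod X z \<otimes>\<^bsub>add_monoid (tensor A X M)\<^esub> Upsilon_mod X w" by simp
  qed (simp add: Upsilon_mod_closed X)
  fix b z assume bz: "b \<in> carrier B" "z \<in> carrier (fobj F X)"
  show "Upsilon_mod X (b \<odot>\<^bsub>fobj F X\<^esub> z) = b \<odot>\<^bsub>tensor A X M\<^esub> Upsilon_mod X z"
    by (rule Upsilon_mod_eqI[OF X])
      (use bz TX.ract_closed in \<open>simp_all add: Upsilon_mod_closed X Theta_mod_ract Theta_mod_Upsilon_mod\<close>)
qed

lemma Upsilon_mod_natural_iso: "natural_iso A B F G Upsilon_mod"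
proof -
  interpret G: covariant_functor A B "G :: ('u, 'u, 'b, ('u \<times> 'v \<Rightarrow>\<^sub>0 int) set) mod_functor"
    by (rule tensor_covariant_functor)
  show ?thesis
  proof unfold_locales
    show "Upsilon_mod \<in> extensional (UMod A)" by (simp add: Upsilon_mod_def)
  next
    fix X :: "('u, 'u) module" assume X: "X \<in> UMod A"
    show m: "Upsilon_mod X \<in> mhom B (fobj F X) (fobj G X)" unfolding G_obj by (rule Upsilon_mod_mhom[OF X])
    have "bij_betw (Upsilon_mod X) (carrier (fobj F X)) (carrier (fobj G X))"
      using Theta_mod_Upsilon_mod[OF X] Upsilon_mod_closed[OF X] Upsilon_mod_eqI[OF X] Theta_mod_surj[OF X]
      by (intro bij_betw_byWitness[where f' = "Theta_mod X"]) (auto simp: G_obj)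
    with m show "Upsilon_mod X \<in> miso B (fobj F X) (fobj G X)" by (simp add: miso_def)
  next
    fix X Y :: "('u, 'u) module" and f assume X: "X \<in> UMod A" and Y: "Y \<in> UMod A" and f: "f \<in> mhom A X Y"
    have "Upsilon_mod Y (farr F X Y f z) = farr G X Y f (Upsilon_mod X z)" if z: "z \<in> carrier (fobj F X)" for z
    proof (rule Upsilon_mod_eqI[OF Y])
      show "farr G X Y f (Upsilon_mod X z) \<in> carrier (tensor_ag A Y M)"
        using hom_in_carrier[OF G_arr_hom[OF X Y f], of "Upsilon_mod X z"] Upsilon_mod_closed[OF X z] by simp
      show "Theta_mod Y (farr G X Y f (Upsilon_mod X z)) = farr F X Y f z"
        using Theta_mod_natural[OF X Y f Upsilon_mod_closed[OF X z]] Theta_mod_Upsilon_mod[OF X z] by simp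
    qed
    then show "compose (carrier (fobj F X)) (Upsilon_mod Y) (farr F X Y f)
      = compose (carrier (fobj F X)) (farr G X Y f) (Upsilon_mod X)"
      unfolding compose_def by (rule restrict_ext)
  qed
qed

text \<open>A generator \<open>F(\<phi>\<^sub>x)(y)\<close> of \<open>F(X)\<close> is the image of
  an element of \<open>F(eA)\<close> under a morphism \<open>eA \<rightarrow> X\<close>, where
  \<open>x e = x\<close>. Naturality then determines both transformations on it by their components
  at \<open>eA\<close>.\<close>

lemma natural_trans_unique:
  assumes "natural_trans A B F H \<eta>" "natural_trans A B F H \<theta>"
    and eq: "\<And>e. e \<in> Idemp A \<Longrightarrow> \<eta> (pr e) = \<theta> (pr e)"
  shows "\<eta> = \<theta>"
proof (rule extensionalityI[of _ "UMod A"])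
  interpret \<eta>: natural_trans A B F H \<eta> by fact
  interpret \<theta>: natural_trans A B F H \<theta> by fact
  show "\<eta> \<in> extensional (UMod A)" "\<theta> \<in> extensional (UMod A)"
    by (rule \<eta>.extensional \<theta>.extensional)+
  have nat: "\<eta> Y (farr F X Y f z) = farr H X Y f (\<eta> X z)" "\<theta> Y (farr F X Y f z) = farr H X Y f (\<theta> X z)"
    if "X \<in> UMod A" "Y \<in> UMod A" "f \<in> mhom A X Y" "z \<in> carrier (fobj F X)" for X Y f z
    using fun_cong[OF \<eta>.natural[OF that(1-3)], of z] fun_cong[OF \<theta>.natural[OF that(1-3)], of z] that(4)
    by (simp_all add: compose_eq)
  fix X :: "('u, 'u) module" assume X: "X \<in> UMod A"
  interpret HX: abelian_group "fobj H X" by (rule UMod_abelian[OF \<eta>.G.fobj_closed[OF X]])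
  show "\<eta> X = \<theta> X"
  proof (rule mhom_eqI[OF \<eta>.component[OF X] \<theta>.component[OF X]])
    fix z assume z: "z \<in> carrier (fobj F X)"
    show "\<eta> X z = \<theta> X z"
    proof (rule add_hom_eqI[OF UMod_abelian[OF F.fobj_closed[OF X]] HX.abelian_group_axioms
          mhom_hom[OF \<eta>.component[OF X]] mhom_hom[OF \<theta>.component[OF X]] fobj_generate[OF X] _ z])
      fix s assume "s \<in> {farr F R X (orbit_map A X x) y | x y. x \<in> carrier X \<and> y \<in> carrier M}"
      then obtain x y where s: "s = farr F R X (orbit_map A X x) y" and x: "x \<in> carrier X" and y: "y \<in> carrier M"
        by blast
      obtain e where e: "e \<in> Idemp A" "e \<odot>\<^bsub>X\<^esub> x = x"
        using A.local_unit_module[OF UModD[OF X] x] by blast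
      note p = A.principal_mod_UMod[OF e(1)]
      \<comment> \<open>This is \<open>u \<mapsto> x u\<close> on \<open>eA\<close>. It sends
        \<open>e\<close> to \<open>x e = x\<close>, so the orbit map of \<open>x\<close> factors as
        the orbit map of \<open>e\<close> followed by it.\<close>
      let ?f = "compose (carrier (pr e)) (orbit_map A X x) (incl A e)"
      have f: "?f \<in> mhom A (pr e) X"
        by (rule right_module.mhom_compose[OF UMod_right_module[OF p] A.incl_mhom[OF e(1)] orbit_mhom[OF X x]])
      note ee = A.Idemp_in_principal_mod[OF e(1)]
      have "?f e = x"
        using ee e(2) A.Idemp_closed[OF e(1)]
        by (simp add: compose_eq incl_def orbit_map_def del: carrier_principal_mod)
      then have s': "s = farr F (pr e) X ?f (farr F R (pr e) (orbit_map A (pr e) e) y)"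
        using farr_orbit_image[OF p X f ee y] s by simp
      show "\<eta> X s = \<theta> X s"
        unfolding s' nat[OF p X f farr_orbit_closed[OF p ee y]] eq[OF e(1)] ..
    qed
  qed
qed

lemma Upsilon_natural_iso_unique:
  "\<exists>!\<Upsilon>. natural_iso A B F (tensor_functor A M) \<Upsilon> \<and> (\<forall>e \<in> Idemp A. \<Upsilon> (pr e) = Upsilon A F e)"
proof (rule ex1I[of _ Upsilon_mod])
  show "natural_iso A B F G Upsilon_mod \<and> (\<forall>e \<in> Idemp A. Upsilon_mod (pr e) = Upsilon A F e)"
    using Upsilon_mod_natural_iso Upsilon_mod_principal by blast
  fix \<Upsilon> assume *: "natural_iso A B F G \<Upsilon> \<and> (\<forall>e \<in> Idemp A. \<Upsilon> (pr e) = Upsilon A F e)"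
  show "\<Upsilon> = Upsilon_mod"
  proof (rule natural_trans_unique)
    show "natural_trans A B F G \<Upsilon>" using * by (simp add: natural_iso_def)
    show "natural_trans A B F G Upsilon_mod" using Upsilon_mod_natural_iso by (simp add: natural_iso_def)
  qed (use * Upsilon_mod_principal in simp)
qed

lemma Upsilon_Theta:
  assumes e: "e \<in> Idemp A"
  shows "compose (carrier (tensor A (pr e) M)) (Upsilon A F e) (Theta A F e)
    = (\<lambda>t \<in> carrier (tensor A (pr e) M). t)"
  unfolding compose_def Theta_eq[OF e] carrier_tensor by (rule restrict_ext) (rule Upsilon_Theta_mod[OF e])

lemma Theta_Upsilon:
  assumes e: "e \<in> Idemp A"
  shows "compose (carrier (fobj F (pr e))) (Theta A F e) (Upsilon A F e)
    = (\<lambda>y \<in> carrier (fobj F (pr e)). y)"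
  unfolding compose_def Theta_eq[OF e] by (rule restrict_ext) (rule Theta_mod_Upsilon[OF e])

end

theorem lemma3p3:
  fixes K :: "('k, 'r) ring_scheme"
    and A :: "('k, 'u, 's) module_scheme"
    and B :: "('k, 'b, 't) module_scheme"
    and F :: "('u, 'u, 'b, 'v) mod_functor"
  assumes "infinite (UNIV :: 'u set)"
    and "ring_with_local_units K A"
    and "ring_with_local_units K B"
    and "continuous_functor A B F"
  shows "(\<forall>e \<in> Idemp A.
            compose (carrier (tensor A (principal_mod A e) (F_reg A F))) (Upsilon A F e) (Theta A F e)
              = (\<lambda>t \<in> carrier (tensor A (principal_mod A e) (F_reg A F)). t) \<and>
            compose (carrier (fobj F (principal_mod A e))) (Theta A F e) (Upsilon A F e)
              = (\<lambda>y \<in> carrier (fobj F (principal_mod A e)). y)) \<and>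
         (\<exists>!\<Upsilon>. natural_iso A B F (tensor_functor A (F_reg A F)) \<Upsilon> \<and>
            (\<forall>e \<in> Idemp A. \<Upsilon> (principal_mod A e) = Upsilon A F e)) \<and>
         unital_left_module A (F_reg A F) \<and>
         unital_bimodule A B (F_reg A F)"
proof -
  interpret continuous_on_regular K A B F
    using assms by (simp add: continuous_on_regular_def continuous_on_regular_axioms_def)
  show ?thesis
    by (intro conjI ballI Upsilon_Theta Theta_Upsilon Upsilon_natural_iso_unique M_left M_bimodule)
qed

end
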